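(* Let $\{X_i\}_{i\ge1}$ be i.i.d. real random variables with distribution $F$, and suppose that $S_n/V_n$ converges in distribution to a (real) random variable $T$ as $n\to\infty$. Let $r>0$. If $\mathrm{E}|T_{n_0}|^r$ is finite for some integer $n_0\ge2$, then $$\lim_{n\to\infty}\mathrm{E}|T_n|^r=\mathrm{E}|T|^r.$$
   Context: Set $S_n=\sum_{i=1}^n X_i$ and $V_n=\bigl(\sum_{i=1}^n X_i^2\bigr)^{1/2}$, with the convention $S_n/V_n=0$ when $V_n=0$. For $n\ge2$ set $\hat\sigma_n^2=\frac{1}{n-1}\sum_{i=1}^n (X_i-n^{-1}S_n)^2$, with $\hat\sigma_n\ge 0$. The $t$-statistic is $T_n=n^{-1/2}\hat\sigma_n^{-1}S_n$ if $\hat\sigma_n>0$ and $T_n=0$ if $\hat\sigma_n=0$. *)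

theory Defs
  imports "HOL-Probability.Probability"
begin

text \<open>
  A sequence of random variables is a function \<open>X :: nat \<Rightarrow> 'a \<Rightarrow> real\<close>, of which only the
  indices \<open>i \<ge> 1\<close> are used; \<open>\<omega>\<close> is the sample point.
\<close>

definition partial_sum :: "(nat \<Rightarrow> 'a \<Rightarrow> real) \<Rightarrow> nat \<Rightarrow> 'a \<Rightarrow> real" where
  "partial_sum X n \<omega> = (\<Sum>i=1..n. X i \<omega>)"

definition self_norm :: "(nat \<Rightarrow> 'a \<Rightarrow> real) \<Rightarrow> nat \<Rightarrow> 'a \<Rightarrow> real" where
  "self_norm X n \<omega> = sqrt (\<Sum>i=1..n. (X i \<omega>)\<^sup>2)"

definition self_normalized_sum :: "(nat \<Rightarrow> 'a \<Rightarrow> real) \<Rightarrow> nat \<Rightarrow> 'a \<Rightarrow> real" where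
  "self_normalized_sum X n \<omega> =
     (if self_norm X n \<omega> = 0 then 0 else partial_sum X n \<omega> / self_norm X n \<omega>)"

text \<open>Meaningful for \<open>n \<ge> 2\<close>; for \<open>n < 2\<close> the formula yields \<open>0\<close>.\<close>

definition sample_sd :: "(nat \<Rightarrow> 'a \<Rightarrow> real) \<Rightarrow> nat \<Rightarrow> 'a \<Rightarrow> real" where
  "sample_sd X n \<omega> =
     sqrt (1 / (real n - 1) * (\<Sum>i=1..n. (X i \<omega> - partial_sum X n \<omega> / real n)\<^sup>2))"

definition t_statistic :: "(nat \<Rightarrow> 'a \<Rightarrow> real) \<Rightarrow> nat \<Rightarrow> 'a \<Rightarrow> real" where
  "t_statistic X n \<omega> =
     (if sample_sd X n \<omega> > 0 then partial_sum X n \<omega> / (sqrt (real n) * sample_sd X n \<omega>) else 0)"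

text \<open>
  The absolute moment \<open>E |Y|^r\<close>, valued in \<open>[0, \<infinity>]\<close>.  The Bochner integral would
  silently be \<open>0\<close> where the moment is infinite.
\<close>

definition abs_moment :: "'a measure \<Rightarrow> ('a \<Rightarrow> real) \<Rightarrow> real \<Rightarrow> ennreal" where
  "abs_moment M Y r = (\<integral>\<^sup>+ \<omega>. ennreal (\<bar>Y \<omega>\<bar> powr r) \<partial>M)"

end

theory Submission
  imports Defs "HOL-Real_Asymp.Real_Asymp"
begin

text \<open>
  Write \<open>Q\<^sub>n = S\<^sub>n / V\<^sub>n\<close>. Since \<open>T\<^sub>n\<^sup>2 = (n - 1) Q\<^sub>n\<^sup>2 / (n - Q\<^sub>n\<^sup>2)\<close>, the statistics \<open>T\<^sub>n\<close> and \<open>Q\<^sub>n\<close> have the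
  same weak limit, and \<open>\<bar>T\<^sub>n\<bar> \<le> 2 \<bar>Q\<^sub>n\<bar>\<close> unless \<open>Q\<^sub>n\<^sup>2 > 3n/4\<close>; so what is needed is uniform
  integrability of \<open>\<bar>Q\<^sub>n\<bar>\<^sup>r\<close> and that \<open>\<bar>T\<^sub>n\<bar>\<^sup>r\<close> has vanishing mean on \<open>{Q\<^sub>n\<^sup>2 > 3n/4}\<close>.

  For the second point, cut the sample into blocks of a fixed length \<open>m \<ge> 4a\<^sup>2\<close>, where
  \<open>P(\<bar>Q\<^sub>k\<bar> > a) \<le> 1/16\<close> for all \<open>k\<close>. On \<open>{Q\<^sub>n\<^sup>2 > 3n/4}\<close> about two thirds of the blocks have
  \<open>\<bar>Q\<bar> > a\<close>, which is exponentially unlikely. Moreover \<open>\<bar>T\<^sub>n\<bar>\<close> is at most \<open>2n\<close> times the maximum of \<open>1\<close> and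
  the \<open>t\<close>-statistic of some window of \<open>n\<^sub>0\<close> consecutive observations, and a window is independent
  of all the blocks that do not meet it.

  For the first point, every moment of \<open>Q\<^sub>n\<close> is bounded. Up to a constant, \<open>Q\<^sub>n ^ (2q)\<close> is dominated by the
  sum over the dyadic scales \<open>s\<close> of \<open>(cosh (b s S\<^sub>n) - 1) exp (-s\<^sup>2 V\<^sub>n\<^sup>2)\<close>, whose expectations factorize.
  With \<open>h(s) = E (1 - exp (-s\<^sup>2 X\<^sup>2))\<close>, tightness applied at sample size \<open>n \<approx> 1/(2h(s))\<close> gives
  \<open>(E s X exp (-s\<^sup>2 X\<^sup>2))\<^sup>2 \<le> C h(s) E (s\<^sup>2 X\<^sup>2 exp (-s\<^sup>2 X\<^sup>2))\<close>. Hence for a small fixed \<open>b\<close> the term of scale \<open>s\<close> is at most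
  \<open>n (h(s) - h(s/2)) exp (-n h(s) / 4)\<close>, and these bounds add up by telescoping.
\<close>

section \<open>Self-normalized sums and the t-statistic\<close>

text \<open>This is \<open>n - 1\<close> times the squared sample standard deviation. Without that
  factor, the deviation of a window can be compared directly with that of the whole sample.\<close>

definition sq_dev :: "(nat \<Rightarrow> 'a \<Rightarrow> real) \<Rightarrow> nat \<Rightarrow> 'a \<Rightarrow> real" where
  "sq_dev X n \<omega> = (\<Sum>i=1..n. (X i \<omega> - partial_sum X n \<omega> / real n)\<^sup>2)"

lemma sq_dev_nonneg: "sq_dev X n \<omega> \<ge> 0"
  unfolding sq_dev_def by (intro sum_nonneg) auto

lemma self_norm_nonneg: "self_norm X n \<omega> \<ge> 0"
  unfolding self_norm_def by (auto intro!: sum_nonneg)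

lemma self_norm_sq: "(self_norm X n \<omega>)\<^sup>2 = (\<Sum>i=1..n. (X i \<omega>)\<^sup>2)"
  unfolding self_norm_def by (auto intro!: real_sqrt_pow2 sum_nonneg)

lemma sum_sq_diff:
  fixes c :: real
  shows "(\<Sum>i=1..n. (X i \<omega> - c)\<^sup>2)
    = (self_norm X n \<omega>)\<^sup>2 - 2 * c * partial_sum X n \<omega> + real n * c\<^sup>2"
  unfolding self_norm_sq partial_sum_def
  by (simp add: power2_diff sum.distrib sum_subtractf sum_distrib_left mult_ac)

lemma sq_dev_eq:
  assumes "n \<ge> 1"
  shows "sq_dev X n \<omega> = (self_norm X n \<omega>)\<^sup>2 - (partial_sum X n \<omega>)\<^sup>2 / real n"
  unfolding sq_dev_def sum_sq_diff using assms
  by (simp add: field_simps power2_eq_square)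

text \<open>The mean is the minimizer: the gap is \<open>n\<close> times the squared distance from
  \<open>c\<close> to the mean. This allows a window to be centred at the mean of the whole
  sample.\<close>

lemma sq_dev_le:
  fixes c :: real
  assumes "n \<ge> 1"
  shows "sq_dev X n \<omega> \<le> (\<Sum>i=1..n. (X i \<omega> - c)\<^sup>2)"
proof -
  have "(\<Sum>i=1..n. (X i \<omega> - c)\<^sup>2) - sq_dev X n \<omega> = real n * (c - partial_sum X n \<omega> / real n)\<^sup>2"
    unfolding sq_dev_eq[OF assms] sum_sq_diff using assms
    by (simp add: field_simps power2_eq_square)
  also have "\<dots> \<ge> 0" by simp
  finally show ?thesis by simp
qed

text \<open>The convention for a vanishing norm does no harm, because then every observation is
  zero.\<close>

lemma partial_sum_eq:
  "partial_sum X n \<omega> = self_normalized_sum X n \<omega> * self_norm X n \<omega>"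
proof (cases "self_norm X n \<omega> = 0")
  case True
  then have "(\<Sum>i=1..n. (X i \<omega>)\<^sup>2) = 0"
    using self_norm_sq[of X n \<omega>] by simp
  then have "\<forall>i\<in>{1..n}. X i \<omega> = 0"
    by (subst (asm) sum_nonneg_eq_0_iff) auto
  then show ?thesis
    using True by (simp add: partial_sum_def)
qed (simp add: self_normalized_sum_def)

text \<open>This is Cauchy-Schwarz, read off from the nonnegativity of
  \<open>sq_dev\<close>.\<close>

lemma partial_sum_sq_le: "(partial_sum X n \<omega>)\<^sup>2 \<le> real n * (self_norm X n \<omega>)\<^sup>2"
proof (cases "n \<ge> 1")
  case True
  then show ?thesis
    using sq_dev_nonneg[of X n \<omega>] unfolding sq_dev_eq[OF True] by (simp add: field_simps)
qed (simp add: partial_sum_def)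

lemma self_normalized_sum_sq_le: "(self_normalized_sum X n \<omega>)\<^sup>2 \<le> real n"
proof (cases "self_norm X n \<omega> = 0")
  case False
  then have "(self_norm X n \<omega>)\<^sup>2 > 0" by simp
  then show ?thesis
    using partial_sum_sq_le[of X n \<omega>] False
    by (simp add: self_normalized_sum_def power_divide divide_le_eq)
qed (simp add: self_normalized_sum_def)

lemma sample_sd_eq: "sample_sd X n \<omega> = sqrt (sq_dev X n \<omega> / (real n - 1))"
  by (simp add: sample_sd_def sq_dev_def)

lemma t_statistic_sq:
  assumes "n \<ge> 2"
  shows "(t_statistic X n \<omega>)\<^sup>2 =
    (real n - 1) * (partial_sum X n \<omega>)\<^sup>2 / (real n * sq_dev X n \<omega>)"
proof (cases "sq_dev X n \<omega> = 0")
  case True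
  then show ?thesis by (simp add: t_statistic_def sample_sd_eq)
next
  case False
  then have "sq_dev X n \<omega> > 0" using sq_dev_nonneg[of X n \<omega>] by simp
  with assms show ?thesis
    by (simp add: t_statistic_def sample_sd_eq power_divide power_mult_distrib field_simps)
qed

lemma t_statistic_sq_self_normalized_sum:
  assumes "n \<ge> 2" and "(self_normalized_sum X n \<omega>)\<^sup>2 < real n"
  shows "(t_statistic X n \<omega>)\<^sup>2 =
    (real n - 1) * (self_normalized_sum X n \<omega>)\<^sup>2 / (real n - (self_normalized_sum X n \<omega>)\<^sup>2)"
proof (cases "self_norm X n \<omega> = 0")
  case True
  then show ?thesis
    using partial_sum_eq[of X n \<omega>] t_statistic_sq[OF assms(1), of X \<omega>]
    by (simp add: self_normalized_sum_def)
next
  case False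
  define q v where "q = self_normalized_sum X n \<omega>" and "v = self_norm X n \<omega>"
  have "real n * sq_dev X n \<omega> = v\<^sup>2 * (real n - q\<^sup>2)"
    using assms(1) by (simp add: sq_dev_eq partial_sum_eq field_simps q_def v_def)
  then have "(t_statistic X n \<omega>)\<^sup>2 = (real n - 1) * (q * v)\<^sup>2 / (v\<^sup>2 * (real n - q\<^sup>2))"
    by (simp add: t_statistic_sq[OF assms(1)] partial_sum_eq[of X n \<omega>] q_def v_def)
  then show ?thesis
    using False by (simp add: q_def v_def power_mult_distrib)
qed

text \<open>The factor \<open>(n - 1) / (n - x)\<close> increases with \<open>x\<close>. For fixed
  \<open>b\<close> it tends to 1 as \<open>n\<close> grows, so with the matching lower bound the two
  statistics agree asymptotically wherever the self-normalized sum stays bounded.\<close>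

lemma abs_t_statistic_le:
  assumes "n \<ge> 2" and "(self_normalized_sum X n \<omega>)\<^sup>2 \<le> b" and "b < real n"
  shows "\<bar>t_statistic X n \<omega>\<bar> \<le> sqrt ((real n - 1) / (real n - b)) * \<bar>self_normalized_sum X n \<omega>\<bar>"
proof -
  define q where "q = self_normalized_sum X n \<omega>"
  have "(t_statistic X n \<omega>)\<^sup>2 = (real n - 1) / (real n - q\<^sup>2) * q\<^sup>2"
    using assms by (subst t_statistic_sq_self_normalized_sum) (auto simp: q_def)
  also have "\<dots> \<le> (real n - 1) / (real n - b) * q\<^sup>2"
    using assms by (intro mult_right_mono divide_left_mono mult_pos_pos) (auto simp: q_def)
  finally have "sqrt ((t_statistic X n \<omega>)\<^sup>2) \<le> sqrt ((real n - 1) / (real n - b) * q\<^sup>2)"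
    by (rule real_sqrt_le_mono)
  then show ?thesis unfolding real_sqrt_mult by (simp add: q_def)
qed

lemma abs_t_statistic_ge:
  assumes "n \<ge> 2" and "(self_normalized_sum X n \<omega>)\<^sup>2 < real n"
  shows "sqrt ((real n - 1) / real n) * \<bar>self_normalized_sum X n \<omega>\<bar> \<le> \<bar>t_statistic X n \<omega>\<bar>"
proof -
  define q where "q = self_normalized_sum X n \<omega>"
  have "(real n - 1) / real n * q\<^sup>2 \<le> (real n - 1) / (real n - q\<^sup>2) * q\<^sup>2"
    using assms by (intro mult_right_mono divide_left_mono mult_pos_pos) (auto simp: q_def)
  also have "\<dots> = (t_statistic X n \<omega>)\<^sup>2"
    using assms by (subst t_statistic_sq_self_normalized_sum) (auto simp: q_def)
  finally have "sqrt ((real n - 1) / real n * q\<^sup>2) \<le> sqrt ((t_statistic X n \<omega>)\<^sup>2)"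
    by (rule real_sqrt_le_mono)
  then show ?thesis unfolding real_sqrt_mult by (simp add: q_def)
qed

lemma abs_t_statistic_le_2:
  assumes "n \<ge> 2" and "(self_normalized_sum X n \<omega>)\<^sup>2 \<le> 3 / 4 * real n"
  shows "\<bar>t_statistic X n \<omega>\<bar> \<le> 2 * \<bar>self_normalized_sum X n \<omega>\<bar>"
proof -
  have "\<bar>t_statistic X n \<omega>\<bar>
      \<le> sqrt ((real n - 1) / (real n - 3 / 4 * real n)) * \<bar>self_normalized_sum X n \<omega>\<bar>"
    using assms by (intro abs_t_statistic_le) auto
  also have "\<dots> \<le> sqrt (2\<^sup>2) * \<bar>self_normalized_sum X n \<omega>\<bar>"
    using assms(1) by (intro mult_right_mono real_sqrt_le_mono) (auto simp: field_simps)
  finally show ?thesis by simp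
qed

section \<open>Cutting the sample into blocks\<close>

lemma self_norm_sq_shift:
  "(self_norm X (k + l) \<omega>)\<^sup>2 = (self_norm X k \<omega>)\<^sup>2 + (self_norm (\<lambda>i. X (k + i)) l \<omega>)\<^sup>2"
  and partial_sum_shift:
  "partial_sum X (k + l) \<omega> = partial_sum X k \<omega> + partial_sum (\<lambda>i. X (k + i)) l \<omega>"
  unfolding self_norm_sq partial_sum_def
  by (induction l) (simp_all add: add.assoc)

text \<open>Cauchy-Schwarz for two summands: the cross term \<open>2 s t\<close> is at most
  \<open>c v + d u\<close> by the inequality of arithmetic and geometric means. It glues bounds on
  adjacent stretches of the sample, and the constants add up.\<close>

lemma square_sum_le:
  fixes s t c d u v :: real
  assumes "s\<^sup>2 \<le> c * u" "t\<^sup>2 \<le> d * v" "c \<ge> 0" "d \<ge> 0" "u \<ge> 0" "v \<ge> 0"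
  shows "(s + t)\<^sup>2 \<le> (c + d) * (u + v)"
proof -
  have "(s * t)\<^sup>2 \<le> (c * u) * (d * v)"
    using assms by (simp add: power_mult_distrib mult_mono)
  also have "\<dots> = (c * v) * (d * u)" by simp
  also have "\<dots> \<le> ((c * v + d * u) / 2)\<^sup>2"
    using sum_squares_ge_zero[of "c * v - d * u" 0]
    by (simp add: power2_eq_square field_simps)
  finally have "\<bar>s * t\<bar> \<le> \<bar>(c * v + d * u) / 2\<bar>"
    by (rule abs_le_square_iff[THEN iffD2])
  moreover have "c * v + d * u \<ge> 0"
    using assms by simp
  ultimately have "2 * (s * t) \<le> c * v + d * u"
    using abs_ge_self[of "s * t"] by simp
  with assms(1,2) show ?thesis
    by (simp add: power2_sum algebra_simps)
qed

text \<open>A block beyond the threshold \<open>a\<close> is charged the Cauchy-Schwarz constant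
  \<open>m\<close>, any other block only \<open>a\<^sup>2\<close>; \<open>square_sum_le\<close> adds
  the charges.\<close>

lemma partial_sum_sq_le_blocks:
  fixes X :: "nat \<Rightarrow> 'a \<Rightarrow> real"
    and \<omega> :: 'a and m :: nat and a :: real
  assumes "a \<ge> 0"
  defines "c \<equiv> \<lambda>j. if \<bar>self_normalized_sum (\<lambda>i. X (j * m + i)) m \<omega>\<bar> > a then real m else a\<^sup>2"
  shows "(partial_sum X (N * m) \<omega>)\<^sup>2 \<le> (\<Sum>j<N. c j) * (self_norm X (N * m) \<omega>)\<^sup>2"
proof (induction N)
  case (Suc N)
  let ?Y = "\<lambda>i. X (N * m + i)"
  have "(partial_sum ?Y m \<omega>)\<^sup>2 \<le> c N * (self_norm ?Y m \<omega>)\<^sup>2"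
  proof (cases "\<bar>self_normalized_sum ?Y m \<omega>\<bar> > a")
    case False
    then have "(self_normalized_sum ?Y m \<omega>)\<^sup>2 \<le> a\<^sup>2"
      using assms(1) by (simp add: abs_le_square_iff[symmetric])
    then show ?thesis
      using False unfolding partial_sum_eq c_def power_mult_distrib
      by (auto intro: mult_right_mono)
  qed (simp add: c_def partial_sum_sq_le)
  then have "(partial_sum X (N * m) \<omega> + partial_sum ?Y m \<omega>)\<^sup>2
      \<le> ((\<Sum>j<N. c j) + c N) * ((self_norm X (N * m) \<omega>)\<^sup>2 + (self_norm ?Y m \<omega>)\<^sup>2)"
    using Suc.IH by (intro square_sum_le) (auto intro!: sum_nonneg simp: c_def)
  then show ?case
    using self_norm_sq_shift[of X "N * m" m \<omega>] partial_sum_shift[of X "N * m" m \<omega>]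
    by (simp add: add.commute)
qed (simp add: partial_sum_def)

text \<open>Since \<open>a\<^sup>2 \<le> m / 4\<close>, every full block costs at most
  \<open>m / 4\<close>, and a bad one at most \<open>3 m / 4\<close> more. The incomplete block at
  the end costs at most its length, hence at most \<open>m\<close>.\<close>

lemma self_normalized_sum_sq_le_blocks:
  assumes "a \<ge> 0" and "a\<^sup>2 \<le> real m / 4" and "m > 0"
  shows "(self_normalized_sum X n \<omega>)\<^sup>2 \<le> real m + real m / 4 * real (n div m)
    + 3 / 4 * real m * real (card {j. j < n div m \<and> \<bar>self_normalized_sum (\<lambda>i. X (j * m + i)) m \<omega>\<bar> > a})"
proof -
  define N s where "N = n div m" and "s = n mod m"
  have n: "n = N * m + s" by (simp add: N_def s_def)
  let ?bad = "\<lambda>j. \<bar>self_normalized_sum (\<lambda>i. X (j * m + i)) m \<omega>\<bar> > a"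
  let ?c = "\<lambda>j. if ?bad j then real m else a\<^sup>2"
  let ?Y = "\<lambda>i. X (N * m + i)"
  have "(partial_sum X (N * m) \<omega> + partial_sum ?Y s \<omega>)\<^sup>2
      \<le> ((\<Sum>j<N. ?c j) + real s) * ((self_norm X (N * m) \<omega>)\<^sup>2 + (self_norm ?Y s \<omega>)\<^sup>2)"
    by (intro square_sum_le partial_sum_sq_le_blocks partial_sum_sq_le assms) (auto intro!: sum_nonneg)
  then have *: "(partial_sum X n \<omega>)\<^sup>2 \<le> ((\<Sum>j<N. ?c j) + real s) * (self_norm X n \<omega>)\<^sup>2"
    by (simp add: n self_norm_sq_shift partial_sum_shift)
  have "(self_normalized_sum X n \<omega>)\<^sup>2 \<le> (\<Sum>j<N. ?c j) + real s"
  proof (cases "self_norm X n \<omega> = 0")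
    case True
    then show ?thesis by (simp add: self_normalized_sum_def add_nonneg_nonneg sum_nonneg)
  next
    case False
    then show ?thesis using *
      by (simp add: self_normalized_sum_def power_divide divide_le_eq)
  qed
  also have "(\<Sum>j<N. ?c j) \<le> (\<Sum>j<N. real m / 4 + (if ?bad j then 3 / 4 * real m else 0))"
    using assms by (intro sum_mono) auto
  also have "\<dots> = real m / 4 * real N + 3 / 4 * real m * real (card {j. j < N \<and> ?bad j})"
    by (simp add: sum.distrib sum.If_cases Int_def mult_ac)
  also have "real s \<le> real m"
    using assms(3) by (simp add: s_def less_imp_le)
  finally show ?thesis by (simp add: N_def)
qed

text \<open>With \<open>N = n div m\<close> and \<open>b\<close> bad blocks, the preceding bound
  gives \<open>3/4 N m < m + N m / 4 + 3/4 m b\<close>. Multiplying by \<open>4 / m\<close> yields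
  the claim; the 4 stems from the incomplete block.\<close>

lemma many_bad_blocks:
  assumes "a \<ge> 0" "a\<^sup>2 \<le> real m / 4" "m > 0"
    and "(self_normalized_sum X n \<omega>)\<^sup>2 > 3 / 4 * real n"
  shows "2 * (n div m) \<le>
    3 * card {j. j < n div m \<and> \<bar>self_normalized_sum (\<lambda>i. X (j * m + i)) m \<omega>\<bar> > a} + 4"
proof -
  let ?b = "card {j. j < n div m \<and> \<bar>self_normalized_sum (\<lambda>i. X (j * m + i)) m \<omega>\<bar> > a}"
  have "real (n div m * m) \<le> real n" by (rule of_nat_mono) simp
  then have "3 / 4 * (real (n div m) * real m) \<le> 3 / 4 * real n"
    unfolding of_nat_mult by (simp add: mult.commute)
  also have "\<dots> < real m + real m / 4 * real (n div m) + 3 / 4 * real m * real ?b"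
    using self_normalized_sum_sq_le_blocks[OF assms(1-3), of X n \<omega>] assms(4) by simp
  finally have "real m * (2 * real (n div m)) < real m * (3 * real ?b + 4)"
    by (simp add: algebra_simps)
  then have "2 * real (n div m) < 3 * real ?b + 4"
    using assms(3) by simp
  then show ?thesis by linarith
qed

text \<open>Let \<open>c\<close> be the sample mean. If \<open>D \<ge> c\<^sup>2 / 4\<close>, the
  statistic is at most \<open>2 n\<close>, whence the maximum with 1. If \<open>D\<close> is
  positive but smaller, all observations are within \<open>|c| / 2\<close> of \<open>c\<close>, so
  the sum over any window is at least \<open>|c|\<close> in absolute value. A window that is not
  constant has positive deviation at most \<open>D\<close>, hence a comparably large
  statistic.\<close>

lemma abs_t_statistic_le_window:
  assumes "n0 \<ge> 2" and "n0 \<le> n"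
  shows "\<exists>i\<le>n - n0. \<bar>t_statistic X n \<omega>\<bar> \<le> 2 * real n * max 1 \<bar>t_statistic (\<lambda>j. X (i + j)) n0 \<omega>\<bar>"
proof -
  define S where "S = partial_sum X n \<omega>"
  define D where "D = sq_dev X n \<omega>"
  have D0: "D \<ge> 0" unfolding D_def by (rule sq_dev_nonneg)
  have n2: "n \<ge> 2" using assms by simp
  have T: "(t_statistic X n \<omega>)\<^sup>2 = (real n - 1) / real n * (S\<^sup>2 / D)"
    using t_statistic_sq[OF n2, of X \<omega>] by (simp add: S_def D_def)
  also have "\<dots> \<le> 1 * (S\<^sup>2 / D)"
    using n2 D0 by (intro mult_right_mono) auto
  finally have T_le: "(t_statistic X n \<omega>)\<^sup>2 \<le> S\<^sup>2 / D" by simp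
  consider "D = 0" | "D > 0" "(S / real n)\<^sup>2 / 4 \<le> D" | "D > 0" "D < (S / real n)\<^sup>2 / 4"
    using D0 by force
  then show ?thesis
  proof cases
    case 1
    then have "t_statistic X n \<omega> = 0" using T by simp
    then show ?thesis by (intro exI[of _ 0]) auto
  next
    case 2
    have "S\<^sup>2 / D \<le> (2 * real n)\<^sup>2"
      using 2 n2 by (simp add: divide_le_eq power_mult_distrib power_divide mult_ac)
    with T_le have "(t_statistic X n \<omega>)\<^sup>2 \<le> (2 * real n)\<^sup>2"
      by linarith
    then have "\<bar>t_statistic X n \<omega>\<bar> \<le> \<bar>2 * real n\<bar>"
      by (rule abs_le_square_iff[THEN iffD2])
    also have "\<dots> \<le> 2 * real n * max 1 \<bar>t_statistic (\<lambda>j. X (0 + j)) n0 \<omega>\<bar>"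
      using n2 mult_left_mono[of 1 "max 1 \<bar>t_statistic (\<lambda>j. X (0 + j)) n0 \<omega>\<bar>" "2 * real n"]
      by simp
    finally show ?thesis by blast
  next
    case 3
    define c where "c = S / real n"
    have close: "\<bar>X i \<omega> - c\<bar> \<le> \<bar>c\<bar> / 2" if "i \<in> {1..n}" for i
    proof -
      have "(X i \<omega> - c)\<^sup>2 \<le> D"
        unfolding D_def sq_dev_def c_def S_def using that by (intro member_le_sum) auto
      also have "D \<le> (c / 2)\<^sup>2"
        using 3(2) by (simp add: c_def power_divide)
      finally have "\<bar>X i \<omega> - c\<bar> \<le> \<bar>c / 2\<bar>"
        by (rule abs_le_square_iff[THEN iffD2])
      then show ?thesis by simp
    qed
    \<comment> \<open>If all neighbours agreed, the sample would be constant and \<open>D\<close>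
      would vanish.\<close>
    have "\<exists>k\<ge>1. k < n \<and> X k \<omega> \<noteq> X (Suc k) \<omega>"
    proof (rule ccontr)
      assume "\<not> ?thesis"
      then have step: "X (Suc k) \<omega> = X k \<omega>" if "1 \<le> k" "k < n" for k
        using that by auto
      have const: "X i \<omega> = X 1 \<omega>" if "1 \<le> i" "i \<le> n" for i
        using that by (induction i rule: dec_induct) (auto simp: step)
      have "D \<le> (\<Sum>i=1..n. (X i \<omega> - X 1 \<omega>)\<^sup>2)"
        unfolding D_def using n2 by (intro sq_dev_le) auto
      also have "\<dots> = 0"
      proof (intro sum.neutral ballI)
        fix i assume "i \<in> {1..n}"
        then show "(X i \<omega> - X 1 \<omega>)\<^sup>2 = 0" using const[of i] by simp
      qed
      finally show False using 3 by simp
    qed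
    then obtain k where k: "1 \<le> k" "k < n" "X k \<omega> \<noteq> X (Suc k) \<omega>" by blast
    \<comment> \<open>The window covers \<open>i + 1\<close> to \<open>i + n0\<close>. It starts at
      \<open>k\<close> unless it would overrun the sample; in both cases it contains
      \<open>k\<close> and \<open>Suc k\<close>.\<close>
    define i where "i = min (k - 1) (n - n0)"
    define l where "l = k - i"
    have l: "1 \<le> l" "Suc l \<le> n0" "k = i + l"
      using k assms by (auto simp: i_def l_def)
    have i: "i \<le> n - n0" by (simp add: i_def)
    define Y where "Y = (\<lambda>j. X (i + j))"
    define E where "E = sq_dev Y n0 \<omega>"
    have "E \<noteq> 0"
    proof
      assume "E = 0"
      then have "\<forall>j\<in>{1..n0}. (Y j \<omega> - partial_sum Y n0 \<omega> / real n0)\<^sup>2 = 0"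
        unfolding E_def sq_dev_def by (subst (asm) sum_nonneg_eq_0_iff) auto
      moreover have "l \<in> {1..n0}" "Suc l \<in> {1..n0}" using l by auto
      ultimately have "Y l \<omega> = Y (Suc l) \<omega>" by auto
      with k l show False by (simp add: Y_def)
    qed
    then have E0: "E > 0"
      using sq_dev_nonneg[of Y n0 \<omega>] by (simp add: E_def)
    have "E \<le> (\<Sum>j=1..n0. (X (i + j) \<omega> - c)\<^sup>2)"
      unfolding E_def Y_def using assms by (intro sq_dev_le) auto
    also have "\<dots> = (\<Sum>j\<in>(+) i ` {1..n0}. (X j \<omega> - c)\<^sup>2)"
      by (subst sum.reindex) auto
    also have "\<dots> \<le> D"
      unfolding D_def sq_dev_def c_def S_def using i assms by (intro sum_mono2) auto
    finally have ED: "E \<le> D" .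
    \<comment> \<open>The window sum deviates from \<open>n0 * c\<close> by at most half of
      \<open>n0 * |c|\<close>; as \<open>n0 \<ge> 2\<close>, the remaining half is at least
      \<open>|c|\<close>.\<close>
    have "\<bar>partial_sum Y n0 \<omega> - real n0 * c\<bar> = \<bar>\<Sum>j=1..n0. (X (i + j) \<omega> - c)\<bar>"
      by (simp add: partial_sum_def Y_def sum_subtractf)
    also have "\<dots> \<le> (\<Sum>j=1..n0. \<bar>X (i + j) \<omega> - c\<bar>)"
      by (rule sum_abs)
    also have "\<dots> \<le> (\<Sum>j=1..n0. \<bar>c\<bar> / 2)"
      using i assms by (intro sum_mono close) auto
    also have "\<dots> = real n0 * \<bar>c\<bar> / 2" by simp
    finally have "\<bar>real n0 * c\<bar> - \<bar>partial_sum Y n0 \<omega>\<bar> \<le> real n0 * \<bar>c\<bar> / 2"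
      by linarith
    then have "real n0 * \<bar>c\<bar> / 2 \<le> \<bar>partial_sum Y n0 \<omega>\<bar>"
      by (simp add: abs_mult mult.commute)
    moreover have "2 * \<bar>c\<bar> / 2 \<le> real n0 * \<bar>c\<bar> / 2"
      using assms by (intro divide_right_mono mult_right_mono) auto
    ultimately have "\<bar>c\<bar> \<le> \<bar>partial_sum Y n0 \<omega>\<bar>" by linarith
    then have c_le: "c\<^sup>2 \<le> (partial_sum Y n0 \<omega>)\<^sup>2"
      by (simp add: abs_le_square_iff)
    have "S\<^sup>2 / D = (real n)\<^sup>2 * (c\<^sup>2 / D)"
      using n2 by (simp add: c_def power_divide)
    also have "\<dots> \<le> (real n)\<^sup>2 * ((partial_sum Y n0 \<omega>)\<^sup>2 / E)"
      using c_le ED E0 by (intro mult_left_mono frac_le) auto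
    \<comment> \<open>The factor 2 compensates for \<open>(n0 - 1) / n0 \<ge> 1 / 2\<close>.\<close>
    also have "\<dots> \<le> (real n)\<^sup>2 * (2 * (t_statistic Y n0 \<omega>)\<^sup>2)"
    proof (intro mult_left_mono)
      have "1 / 2 * ((partial_sum Y n0 \<omega>)\<^sup>2 / E) \<le> (real n0 - 1) / real n0 * ((partial_sum Y n0 \<omega>)\<^sup>2 / E)"
        using assms E0 by (intro mult_right_mono) (auto simp: field_simps)
      also have "\<dots> = (t_statistic Y n0 \<omega>)\<^sup>2"
        using t_statistic_sq[OF assms(1), of Y \<omega>] by (simp add: E_def)
      finally show "(partial_sum Y n0 \<omega>)\<^sup>2 / E \<le> 2 * (t_statistic Y n0 \<omega>)\<^sup>2" by simp
    qed simp
    also have "\<dots> \<le> (2 * real n * t_statistic Y n0 \<omega>)\<^sup>2"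
      by (simp add: power_mult_distrib mult_right_mono)
    finally have "(t_statistic X n \<omega>)\<^sup>2 \<le> (2 * real n * t_statistic Y n0 \<omega>)\<^sup>2"
      using T_le by linarith
    then have "\<bar>t_statistic X n \<omega>\<bar> \<le> \<bar>2 * real n * t_statistic Y n0 \<omega>\<bar>"
      by (rule abs_le_square_iff[THEN iffD2])
    also have "\<dots> \<le> 2 * real n * max 1 \<bar>t_statistic Y n0 \<omega>\<bar>"
      by (simp add: abs_mult mult_left_mono)
    finally show ?thesis using i by (auto simp: Y_def)
  qed
qed

section \<open>Independent identically distributed sequences\<close>

locale iid_sequence = prob_space M for M :: "'a measure" +
  fixes X :: "nat \<Rightarrow> 'a \<Rightarrow> real" and F :: "real measure"
  assumes indep: "indep_vars (\<lambda>_. borel) X {1..}"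
    and distr_X: "i \<ge> 1 \<Longrightarrow> distr M borel (X i) = F"
begin

lemma measurable_X [measurable]: "i \<ge> 1 \<Longrightarrow> X i \<in> borel_measurable M"
  using indep by (auto simp: indep_vars_def)

lemma F_eq: "F = distr M borel (X 1)"
  using distr_X[of 1] by simp

lemma sets_F [simp, measurable_cong]: "sets F = sets borel"
  by (simp add: F_eq)

lemma prob_space_F: "prob_space F"
  unfolding F_eq by (intro prob_space_distr) simp

sublocale F: prob_space F
  by (rule prob_space_F)

lemma partial_sum_measurable [measurable]:
  "partial_sum (\<lambda>i. X (k + i)) n \<in> borel_measurable M" "partial_sum X n \<in> borel_measurable M"
  unfolding partial_sum_def[abs_def] by measurable

lemma self_norm_measurable [measurable]:
  "self_norm (\<lambda>i. X (k + i)) n \<in> borel_measurable M" "self_norm X n \<in> borel_measurable M"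
  unfolding self_norm_def[abs_def] by measurable

lemma self_normalized_sum_measurable [measurable]:
  "self_normalized_sum (\<lambda>i. X (k + i)) n \<in> borel_measurable M"
  "self_normalized_sum X n \<in> borel_measurable M"
  unfolding self_normalized_sum_def[abs_def] by measurable

lemma sample_sd_measurable [measurable]:
  "sample_sd (\<lambda>i. X (k + i)) n \<in> borel_measurable M" "sample_sd X n \<in> borel_measurable M"
  unfolding sample_sd_def[abs_def] by measurable

lemma t_statistic_measurable [measurable]:
  "t_statistic (\<lambda>i. X (k + i)) n \<in> borel_measurable M" "t_statistic X n \<in> borel_measurable M"
  unfolding t_statistic_def[abs_def] by measurable

text \<open>The factors may depend on the index, so that one or two distinguished observations can
  carry a different function. Boundedness supplies integrability.\<close>

lemma
  fixes f :: "nat \<Rightarrow> real \<Rightarrow> real"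
  assumes [measurable]: "\<And>i. f i \<in> borel_measurable borel" and bdd: "\<And>i x. \<bar>f i x\<bar> \<le> B i"
  shows expectation_prod_iid:
      "expectation (\<lambda>\<omega>. \<Prod>i=1..n. f i (X i \<omega>)) = (\<Prod>i=1..n. \<integral>x. f i x \<partial>F)"
    and integrable_prod_iid: "integrable M (\<lambda>\<omega>. \<Prod>i=1..n. f i (X i \<omega>))"
proof -
  have "indep_vars (\<lambda>_. borel) X {1..n}"
    by (rule indep_vars_subset[OF indep]) auto
  then have ind: "indep_vars (\<lambda>_. borel) (\<lambda>i \<omega>. f i (X i \<omega>)) {1..n}"
    by (rule indep_vars_compose2) simp
  have int: "integrable M (\<lambda>\<omega>. f i (X i \<omega>))" if "i \<in> {1..n}" for i
    using that bdd by (intro integrable_const_bound[where B = "B i"]) auto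
  show "integrable M (\<lambda>\<omega>. \<Prod>i=1..n. f i (X i \<omega>))"
    by (rule indep_vars_integrable[OF _ ind int]) auto
  have "expectation (\<lambda>\<omega>. \<Prod>i=1..n. f i (X i \<omega>)) = (\<Prod>i=1..n. expectation (\<lambda>\<omega>. f i (X i \<omega>)))"
    by (rule indep_vars_lebesgue_integral[OF _ ind int]) auto
  also have "\<dots> = (\<Prod>i=1..n. \<integral>x. f i x \<partial>F)"
  proof (rule prod.cong[OF refl])
    fix i assume "i \<in> {1..n}"
    then have i: "i \<ge> 1" by simp
    have "(\<integral>x. f i x \<partial>distr M borel (X i)) = expectation (\<lambda>\<omega>. f i (X i \<omega>))"
      using i by (intro integral_distr) auto
    then show "expectation (\<lambda>\<omega>. f i (X i \<omega>)) = (\<integral>x. f i x \<partial>F)"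
      unfolding distr_X[OF i] ..
  qed
  finally show "expectation (\<lambda>\<omega>. \<Prod>i=1..n. f i (X i \<omega>)) = (\<Prod>i=1..n. \<integral>x. f i x \<partial>F)" .
qed

lemma distr_shift:
  assumes "l \<ge> 1"
  shows "distr M (PiM {1..l} (\<lambda>_. borel)) (\<lambda>\<omega>. \<lambda>i\<in>{1..l}. X (k + i) \<omega>) = PiM {1..l} (\<lambda>_. F)"
proof -
  \<comment> \<open>Grouping the sequence into the singletons \<open>{k + i}\<close> reindexes the
    independent family by the shift.\<close>
  have "indep_vars (\<lambda>i. PiM {k + i} (\<lambda>_. borel)) (\<lambda>i \<omega>. restrict (\<lambda>j. X j \<omega>) {k + i}) {1..l}"
    by (rule indep_vars_restrict[OF indep]) (auto simp: disjoint_family_on_def)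
  then have "indep_vars (\<lambda>_. borel) (\<lambda>i \<omega>. (\<lambda>x. x (k + i)) (restrict (\<lambda>j. X j \<omega>) {k + i})) {1..l}"
    by (rule indep_vars_compose2) auto
  then have "indep_vars (\<lambda>_. borel) (\<lambda>i. X (k + i)) {1..l}"
    by simp
  then have "distr M (PiM {1..l} (\<lambda>_. borel)) (\<lambda>\<omega>. \<lambda>i\<in>{1..l}. X (k + i) \<omega>) =
      PiM {1..l} (\<lambda>i. distr M borel (X (k + i)))"
    using assms by (subst indep_vars_iff_distr_eq_PiM'[symmetric]) auto
  also have "\<dots> = PiM {1..l} (\<lambda>_. F)"
    by (intro PiM_cong) (auto simp: distr_X)
  finally show ?thesis .
qed

lemma nn_integral_shift:
  assumes "l \<ge> 1" and [measurable]: "f \<in> borel_measurable (PiM {1..l} (\<lambda>_. borel))"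
  shows "(\<integral>\<^sup>+\<omega>. f (\<lambda>i\<in>{1..l}. X (k + i) \<omega>) \<partial>M) = (\<integral>\<^sup>+\<omega>. f (\<lambda>i\<in>{1..l}. X i \<omega>) \<partial>M)"
proof -
  have *: "(\<integral>\<^sup>+x. f x \<partial>PiM {1..l} (\<lambda>_. F)) = (\<integral>\<^sup>+\<omega>. f (\<lambda>i\<in>{1..l}. X (k + i) \<omega>) \<partial>M)" for k
    unfolding distr_shift[OF assms(1), of k, symmetric] by (rule nn_integral_distr) measurable
  show ?thesis
    using *[of k] *[of 0] by simp
qed

text \<open>Disjoint segments are independent, and each can be moved to the front because the
  sequence is stationary. The lengths may differ, as required for one window among blocks.\<close>

lemma nn_integral_prod_shift:
  fixes start l :: "'j \<Rightarrow> nat" and f :: "'j \<Rightarrow> (nat \<Rightarrow> real) \<Rightarrow> ennreal"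
  assumes "finite J" and disj: "disjoint_family_on (\<lambda>j. {start j + 1..start j + l j}) J"
    and l: "\<And>j. j \<in> J \<Longrightarrow> l j \<ge> 1"
    and meas [measurable]: "\<And>j. j \<in> J \<Longrightarrow> f j \<in> borel_measurable (PiM {1..l j} (\<lambda>_. borel))"
  shows "(\<integral>\<^sup>+\<omega>. (\<Prod>j\<in>J. f j (\<lambda>i\<in>{1..l j}. X (start j + i) \<omega>)) \<partial>M)
    = (\<Prod>j\<in>J. \<integral>\<^sup>+\<omega>. f j (\<lambda>i\<in>{1..l j}. X i \<omega>) \<partial>M)"
proof -
  let ?K = "\<lambda>j. {start j + 1..start j + l j}"
  have "indep_vars (\<lambda>j. PiM (?K j) (\<lambda>_. borel)) (\<lambda>j \<omega>. restrict (\<lambda>i. X i \<omega>) (?K j)) J"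
    by (rule indep_vars_restrict[OF indep _ disj]) auto
  then have "indep_vars (\<lambda>_. borel)
      (\<lambda>j \<omega>. (\<lambda>x. f j (\<lambda>i\<in>{1..l j}. x (start j + i))) (restrict (\<lambda>i. X i \<omega>) (?K j))) J"
  proof (rule indep_vars_compose2)
    fix j assume "j \<in> J"
    then show "(\<lambda>x. f j (\<lambda>i\<in>{1..l j}. x (start j + i))) \<in> borel_measurable (PiM (?K j) (\<lambda>_. borel))"
      by (intro measurable_compose[OF measurable_restrict meas] measurable_component_singleton) auto
  qed
  also have "(\<lambda>j \<omega>. (\<lambda>x. f j (\<lambda>i\<in>{1..l j}. x (start j + i))) (restrict (\<lambda>i. X i \<omega>) (?K j)))
      = (\<lambda>j \<omega>. f j (\<lambda>i\<in>{1..l j}. X (start j + i) \<omega>))"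
    by (intro ext arg_cong[where f = "f _"]) (auto simp: restrict_def)
  finally have "(\<integral>\<^sup>+\<omega>. (\<Prod>j\<in>J. f j (\<lambda>i\<in>{1..l j}. X (start j + i) \<omega>)) \<partial>M)
      = (\<Prod>j\<in>J. \<integral>\<^sup>+\<omega>. f j (\<lambda>i\<in>{1..l j}. X (start j + i) \<omega>) \<partial>M)"
    by (intro indep_vars_nn_integral \<open>finite J\<close>) auto
  also have "\<dots> = (\<Prod>j\<in>J. \<integral>\<^sup>+\<omega>. f j (\<lambda>i\<in>{1..l j}. X i \<omega>) \<partial>M)"
    by (intro prod.cong refl nn_integral_shift l meas)
  finally show ?thesis .
qed

end

text \<open>Taking the coordinate projections as the sequence turns a statistic into a function of
  the sample vector, the form needed for integration over product spaces.\<close>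

lemma partial_sum_restrict:
  "partial_sum (\<lambda>i x. x i) n (\<lambda>i\<in>{1..n}. Y i \<omega>) = partial_sum Y n \<omega>"
  unfolding partial_sum_def by (intro sum.cong) auto

lemma self_normalized_sum_restrict:
  "self_normalized_sum (\<lambda>i x. x i) n (\<lambda>i\<in>{1..n}. Y i \<omega>) = self_normalized_sum Y n \<omega>"
  unfolding self_normalized_sum_def self_norm_def partial_sum_restrict by simp

lemma t_statistic_restrict:
  "t_statistic (\<lambda>i x. x i) n (\<lambda>i\<in>{1..n}. Y i \<omega>) = t_statistic Y n \<omega>"
  unfolding t_statistic_def sample_sd_def partial_sum_restrict by simp

lemma measurable_PiM_statistics [measurable]:
  fixes n :: nat
  shows "partial_sum (\<lambda>i x. x i) n \<in> borel_measurable (PiM {1..n} (\<lambda>_. borel))"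
    and "self_normalized_sum (\<lambda>i x. x i) n \<in> borel_measurable (PiM {1..n} (\<lambda>_. borel))"
    and "t_statistic (\<lambda>i x. x i) n \<in> borel_measurable (PiM {1..n} (\<lambda>_. borel))"
proof -
  show [measurable]: "partial_sum (\<lambda>i x. x i) n \<in> borel_measurable (PiM {1..n} (\<lambda>_. borel))"
    unfolding partial_sum_def[abs_def] by measurable
  have [measurable]: "self_norm (\<lambda>i x. x i) n \<in> borel_measurable (PiM {1..n} (\<lambda>_. borel))"
    unfolding self_norm_def[abs_def] by measurable
  have [measurable]: "sample_sd (\<lambda>i x. x i) n \<in> borel_measurable (PiM {1..n} (\<lambda>_. borel))"
    unfolding sample_sd_def[abs_def] by measurable
  show "self_normalized_sum (\<lambda>i x. x i) n \<in> borel_measurable (PiM {1..n} (\<lambda>_. borel))"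
    unfolding self_normalized_sum_def[abs_def] by measurable
  show "t_statistic (\<lambda>i x. x i) n \<in> borel_measurable (PiM {1..n} (\<lambda>_. borel))"
    unfolding t_statistic_def[abs_def] by measurable
qed

section \<open>Moments of the self-normalized sum\<close>

lemma exp_minus_one_minus_self_le:
  fixes z :: real
  shows "exp z - 1 - z \<le> z\<^sup>2 * exp \<bar>z\<bar>"
proof -
  have "exp z * (1 - z) \<le> exp z * exp (- z)"
    using exp_ge_add_one_self[of "- z"] by (intro mult_left_mono) auto
  \<comment> \<open>This first-order bound, applied separately for each sign of \<open>z\<close>,
    yields the second-order one.\<close>
  then have *: "exp z - 1 \<le> z * exp z"
    by (simp add: exp_minus algebra_simps)
  show "exp z - 1 - z \<le> z\<^sup>2 * exp \<bar>z\<bar>"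
  proof (cases "z \<ge> 0")
    case True
    have "exp z - 1 - z \<le> z * (exp z - 1)"
      using * by (simp add: algebra_simps)
    also have "\<dots> \<le> z * (z * exp z)"
      using * True by (intro mult_left_mono) auto
    finally show ?thesis using True by (simp add: power2_eq_square)
  next
    case False
    have "exp z - 1 - z \<le> (- z) * (1 - exp z)"
      using * by (simp add: algebra_simps)
    also have "\<dots> \<le> (- z) * (- z)"
    proof (intro mult_left_mono)
      show "1 - exp z \<le> - z" using exp_ge_add_one_self[of z] by linarith
    qed (use False in simp)
    also have "\<dots> \<le> z\<^sup>2 * exp \<bar>z\<bar>"
      by (simp add: power2_eq_square mult_le_cancel_left1)
    finally show ?thesis .
  qed
qed

text \<open>All terms of the series of \<open>cosh\<close> are nonnegative, so it suffices to keep
  those of order 0 and \<open>2 q\<close>, which are distinct because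
  \<open>q \<ge> 1\<close>.\<close>

lemma even_power_le_cosh:
  fixes z :: real
  assumes "q \<ge> 1"
  shows "z ^ (2 * q) \<le> fact (2 * q) * (cosh z - 1)"
proof -
  let ?f = "\<lambda>n. if even n then z ^ n /\<^sub>R fact n else 0"
  have "sum ?f {0, 2 * q} \<le> suminf ?f"
    using cosh_converges[of z] by (intro sum_le_suminf) (auto simp: sums_iff zero_le_even_power)
  also have "\<dots> = cosh z"
    using cosh_converges[of z] by (simp add: sums_iff)
  finally have "z ^ (2 * q) / fact (2 * q) \<le> cosh z - 1"
    using assms by (simp add: field_simps)
  then show ?thesis
    by (simp add: divide_le_eq mult.commute)
qed

lemma power_diff_le:
  fixes x y :: real
  assumes "0 \<le> y" "y \<le> x"
  shows "x ^ Suc n - y ^ Suc n \<le> real (Suc n) * (x - y) * x ^ n"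
proof (induction n)
  case (Suc n)
  have "x ^ Suc (Suc n) - y ^ Suc (Suc n) = x * (x ^ Suc n - y ^ Suc n) + (x - y) * y ^ Suc n"
    by (simp add: algebra_simps)
  also have "\<dots> \<le> x * (real (Suc n) * (x - y) * x ^ n) + (x - y) * x ^ Suc n"
    using assms Suc.IH by (intro add_mono mult_left_mono power_mono) auto
  finally show ?case by (simp add: algebra_simps)
qed simp

text \<open>In this second difference the terms linear in \<open>B\<close> cancel, which leaves a
  factor \<open>B\<^sup>2\<close>. The coefficient survives the induction because
  \<open>k\<^sup>2 + 2 k \<le> (k + 1)\<^sup>2\<close>.\<close>

lemma power_add_power_diff_le:
  fixes A B :: real
  assumes "0 \<le> B" "B \<le> A"
  shows "(A + B) ^ (n + 2) + (A - B) ^ (n + 2) - 2 * A ^ (n + 2) \<le> (real (n + 2))\<^sup>2 * B\<^sup>2 * (A + B) ^ n"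
proof (induction n)
  case 0
  then show ?case by (simp add: power2_eq_square algebra_simps)
next
  case (Suc n)
  let ?u = "(A + B) ^ (n + 2) + (A - B) ^ (n + 2) - 2 * A ^ (n + 2)"
  have "(A + B) ^ (Suc n + 2) + (A - B) ^ (Suc n + 2) - 2 * A ^ (Suc n + 2)
      = A * ?u + B * ((A + B) ^ Suc (Suc n) - (A - B) ^ Suc (Suc n))"
    by (simp add: algebra_simps)
  also have "A * ?u \<le> A * ((real (n + 2))\<^sup>2 * B\<^sup>2 * (A + B) ^ n)"
    using assms Suc.IH by (intro mult_left_mono) auto
  also have "\<dots> \<le> (A + B) * ((real (n + 2))\<^sup>2 * B\<^sup>2 * (A + B) ^ n)"
    using assms by (intro mult_right_mono) auto
  also have "B * ((A + B) ^ Suc (Suc n) - (A - B) ^ Suc (Suc n))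
      \<le> B * (real (Suc (Suc n)) * ((A + B) - (A - B)) * (A + B) ^ Suc n)"
    using assms by (intro mult_left_mono power_diff_le) auto
  also have "(A + B) * ((real (n + 2))\<^sup>2 * B\<^sup>2 * (A + B) ^ n) +
      B * (real (Suc (Suc n)) * ((A + B) - (A - B)) * (A + B) ^ Suc n)
      = ((real (n + 2))\<^sup>2 + 2 * real (n + 2)) * B\<^sup>2 * (A + B) ^ Suc n"
    by (simp add: algebra_simps power2_eq_square)
  also have "\<dots> \<le> (real (Suc n + 2))\<^sup>2 * B\<^sup>2 * (A + B) ^ Suc n"
    using assms by (intro mult_right_mono) (auto simp: power2_eq_square algebra_simps)
  finally show ?case by simp
qed

lemma
  fixes f g :: "'a \<Rightarrow> real"
  assumes [measurable]: "f \<in> borel_measurable M" "g \<in> borel_measurable M"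
    and sq: "integrable M (\<lambda>x. (f x)\<^sup>2)" "integrable M (\<lambda>x. (g x)\<^sup>2)"
  shows integrable_mult_of_square: "integrable M (\<lambda>x. f x * g x)"
    and Cauchy_Schwarz_integral:
      "(\<integral>x. f x * g x \<partial>M)\<^sup>2 \<le> (\<integral>x. (f x)\<^sup>2 \<partial>M) * (\<integral>x. (g x)\<^sup>2 \<partial>M)"
proof -
  show int: "integrable M (\<lambda>x. f x * g x)"
  proof (rule Bochner_Integration.integrable_bound)
    show "integrable M (\<lambda>x. (f x)\<^sup>2 + (g x)\<^sup>2)"
      using sq by (rule Bochner_Integration.integrable_add)
    show "AE x in M. norm (f x * g x) \<le> norm ((f x)\<^sup>2 + (g x)\<^sup>2)"
    proof (intro AE_I2)
      fix x
      have "2 * (\<bar>f x\<bar> * \<bar>g x\<bar>) \<le> (f x)\<^sup>2 + (g x)\<^sup>2"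
        using sum_squares_bound[of "\<bar>f x\<bar>" "\<bar>g x\<bar>"] by simp
      moreover have "0 \<le> \<bar>f x\<bar> * \<bar>g x\<bar>" by simp
      ultimately have "\<bar>f x\<bar> * \<bar>g x\<bar> \<le> (f x)\<^sup>2 + (g x)\<^sup>2" by linarith
      then show "norm (f x * g x) \<le> norm ((f x)\<^sup>2 + (g x)\<^sup>2)"
        by (simp add: abs_mult)
    qed
  qed simp
  define A B C where "A = (\<integral>x. (f x)\<^sup>2 \<partial>M)" and "B = (\<integral>x. f x * g x \<partial>M)" and "C = (\<integral>x. (g x)\<^sup>2 \<partial>M)"
  \<comment> \<open>This is the discriminant argument: the quadratic in \<open>t\<close> is nowhere
    negative.\<close>
  have nonneg: "0 \<le> A - 2 * t * B + t\<^sup>2 * C" for t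
  proof -
    have "0 \<le> (\<integral>x. (f x - t * g x)\<^sup>2 \<partial>M)" by simp
    also have "\<dots> = (\<integral>x. (f x)\<^sup>2 - 2 * t * (f x * g x) + t\<^sup>2 * (g x)\<^sup>2 \<partial>M)"
      by (simp add: power2_eq_square algebra_simps)
    also have "\<dots> = A - 2 * t * B + t\<^sup>2 * C"
      using sq int by (simp add: A_def B_def C_def)
    finally show ?thesis .
  qed
  have "C \<ge> 0" by (simp add: C_def)
  show "(\<integral>x. f x * g x \<partial>M)\<^sup>2 \<le> (\<integral>x. (f x)\<^sup>2 \<partial>M) * (\<integral>x. (g x)\<^sup>2 \<partial>M)"
  proof (cases "C = 0")
    case True
    \<comment> \<open>For \<open>B \<noteq> 0\<close> this choice of \<open>t\<close> would make the
      now linear expression equal to -1.\<close>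
    then have "B = 0"
      using nonneg[of "(A + 1) / (2 * B)"] by (cases "B = 0") auto
    then show ?thesis by (simp add: A_def B_def C_def True)
  next
    case False
    with \<open>C \<ge> 0\<close> have "C > 0" by simp
    \<comment> \<open>The quadratic attains its minimum at \<open>t = B / C\<close>.\<close>
    then have "0 \<le> A - B\<^sup>2 / C"
      using nonneg[of "B / C"] by (simp add: power2_eq_square)
    with \<open>C > 0\<close> have "B\<^sup>2 \<le> A * C" by (simp add: field_simps)
    then show ?thesis by (simp add: A_def B_def C_def)
  qed
qed

lemma mult_exp_neg_le_1: "u * exp (- u) \<le> (1 :: real)"
proof -
  have "u \<le> exp u" using exp_ge_add_one_self[of u] by linarith
  then show ?thesis by (simp add: exp_minus field_simps)
qed

lemma abs_mult_exp_neg_square_le_1: "\<bar>y\<bar> * exp (- y\<^sup>2) \<le> (1 :: real)"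
proof -
  have "\<bar>y\<bar> \<le> 1 + y\<^sup>2"
    using sum_squares_bound[of 1 "\<bar>y\<bar>"] by simp
  also have "\<dots> \<le> exp (y\<^sup>2)" by (rule exp_ge_add_one_self)
  finally show ?thesis by (simp add: exp_minus field_simps)
qed

section \<open>Expectations under the Gaussian weight\<close>

context iid_sequence
begin

text \<open>
  The weight \<open>exp (-s\<^sup>2 V\<^sub>n\<^sup>2)\<close>, which localizes \<open>V\<^sub>n\<close> at scale \<open>1/s\<close>, is a product over the sample;
  \<open>gauss\<close>, \<open>gauss1\<close> and \<open>gauss2\<close> are the moments of \<open>s X\<close> of order 0, 1, 2 under the weight of a single observation.
\<close>

definition gauss :: "real \<Rightarrow> real" where
  "gauss s = (\<integral>x. exp (- (s * x)\<^sup>2) \<partial>F)"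

definition gauss1 :: "real \<Rightarrow> real" where
  "gauss1 s = (\<integral>x. s * x * exp (- (s * x)\<^sup>2) \<partial>F)"

definition gauss2 :: "real \<Rightarrow> real" where
  "gauss2 s = (\<integral>x. (s * x)\<^sup>2 * exp (- (s * x)\<^sup>2) \<partial>F)"

lemma integrable_F_bounded:
  fixes f :: "real \<Rightarrow> real"
  assumes "f \<in> borel_measurable borel" "\<And>x. \<bar>f x\<bar> \<le> B"
  shows "integrable F f"
  using assms by (intro F.integrable_const_bound[where B = B]) auto

lemma integrable_gauss: "integrable F (\<lambda>x. exp (- (s * x)\<^sup>2))"
  by (rule integrable_F_bounded[where B = 1]) auto

lemma integrable_gauss1: "integrable F (\<lambda>x. s * x * exp (- (s * x)\<^sup>2))"
proof (rule integrable_F_bounded[where B = 1])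
  show "\<bar>s * x * exp (- (s * x)\<^sup>2)\<bar> \<le> 1" for x
    using abs_mult_exp_neg_square_le_1[of "s * x"] by (simp add: abs_mult)
qed simp

lemma integrable_gauss2: "integrable F (\<lambda>x. (s * x)\<^sup>2 * exp (- (s * x)\<^sup>2))"
  using mult_exp_neg_le_1 by (intro integrable_F_bounded[where B = 1]) auto

lemma gauss_nonneg: "0 \<le> gauss s" and gauss_le_1: "gauss s \<le> 1"
proof -
  show "0 \<le> gauss s" by (simp add: gauss_def)
  have "gauss s \<le> (\<integral>x. 1 \<partial>F)"
    unfolding gauss_def by (intro integral_mono integrable_gauss) auto
  then show "gauss s \<le> 1" by (simp add: F.prob_space)
qed

lemma gauss2_nonneg: "0 \<le> gauss2 s"
  by (simp add: gauss2_def)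

text \<open>Cauchy-Schwarz with the weight split evenly between the two factors. This crude bound
  serves where \<open>1 - gauss s\<close> is zero or not small.\<close>

lemma gauss1_sq_le_gauss2: "(gauss1 s)\<^sup>2 \<le> gauss2 s"
proof -
  define g where "g = (\<lambda>x. exp (- ((s * x)\<^sup>2) / 2))"
  define f where "f = (\<lambda>x. s * x * g x)"
  have g2: "(\<lambda>x. (g x)\<^sup>2) = (\<lambda>x. exp (- (s * x)\<^sup>2))"
    by (rule ext) (simp add: g_def exp_double[symmetric])
  have [measurable]: "f \<in> borel_measurable F" "g \<in> borel_measurable F"
    by (simp_all add: f_def g_def)
  from g2 have "(\<lambda>x. (f x)\<^sup>2) = (\<lambda>x. (s * x)\<^sup>2 * exp (- (s * x)\<^sup>2))"
    and "(\<lambda>x. f x * g x) = (\<lambda>x. s * x * exp (- (s * x)\<^sup>2))"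
    by (simp_all add: f_def power_mult_distrib[of _ "g _"] power2_eq_square[of "g _"] fun_eq_iff)
  then have "(gauss1 s)\<^sup>2 \<le> gauss2 s * gauss s"
    using Cauchy_Schwarz_integral[of f F g] g2 integrable_gauss[of s] integrable_gauss1[of s] integrable_gauss2[of s]
    by (simp add: gauss_def gauss1_def gauss2_def)
  also have "\<dots> \<le> gauss2 s"
    using gauss2_nonneg gauss_le_1 gauss_nonneg by (intro mult_left_le) auto
  finally show ?thesis .
qed

lemma gauss2_le: "gauss2 s \<le> 1 - gauss s"
proof -
  have "u * exp (- u) \<le> 1 - exp (- u)" for u :: real
  proof -
    have "(1 + u) * exp (- u) \<le> exp u * exp (- u)"
      by (intro mult_right_mono exp_ge_add_one_self) auto
    then show ?thesis by (simp add: exp_minus algebra_simps)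
  qed
  then have "gauss2 s \<le> (\<integral>x. 1 - exp (- (s * x)\<^sup>2) \<partial>F)"
    unfolding gauss2_def using integrable_gauss integrable_gauss2 by (intro integral_mono) auto
  also have "\<dots> = 1 - gauss s"
    using integrable_gauss by (simp add: gauss_def F.prob_space)
  finally show ?thesis .
qed

text \<open>Halving \<open>s\<close> turns \<open>u = (s x)\<^sup>2\<close> into
  \<open>u / 4\<close>, and \<open>u * exp (- u / 2)\<close> is dominated by the resulting change of
  the weight. A second moment thus becomes a difference of adjacent dyadic scales, which is the
  source of the telescoping.\<close>

lemma gauss_half_diff:
  "(\<integral>x. (s * x)\<^sup>2 * exp (- (s * x)\<^sup>2 / 2) \<partial>F) \<le> 4 * (gauss (s / 2) - gauss s)"
  and integrable_gauss_half: "integrable F (\<lambda>x. (s * x)\<^sup>2 * exp (- (s * x)\<^sup>2 / 2))"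
proof -
  have ptw: "u * exp (- u / 2) \<le> 4 * (exp (- u / 4) - exp (- u))" if "u \<ge> 0" for u :: real
  proof -
    have "u / 4 \<le> exp (u / 4) - exp (- u / 2)"
      using exp_ge_add_one_self[of "u / 4"] that exp_le_one_iff[of "- u / 2"] by linarith
    then have "u / 4 * exp (- u / 2) \<le> (exp (u / 4) - exp (- u / 2)) * exp (- u / 2)"
      by (intro mult_right_mono) auto
    also have "\<dots> = exp (- u / 4) - exp (- u)"
      by (simp add: left_diff_distrib exp_add[symmetric])
    finally show ?thesis by simp
  qed
  show int: "integrable F (\<lambda>x. (s * x)\<^sup>2 * exp (- (s * x)\<^sup>2 / 2))"
  proof (rule integrable_F_bounded[where B = 2])
    show "\<bar>(s * x)\<^sup>2 * exp (- (s * x)\<^sup>2 / 2)\<bar> \<le> 2" for x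
      using mult_exp_neg_le_1[of "(s * x)\<^sup>2 / 2"] by simp
  qed simp
  have "(\<integral>x. (s * x)\<^sup>2 * exp (- (s * x)\<^sup>2 / 2) \<partial>F)
      \<le> (\<integral>x. 4 * (exp (- (s / 2 * x)\<^sup>2) - exp (- (s * x)\<^sup>2)) \<partial>F)"
  proof (intro integral_mono int)
    show "integrable F (\<lambda>x. 4 * (exp (- (s / 2 * x)\<^sup>2) - exp (- (s * x)\<^sup>2)))"
      by (intro Bochner_Integration.integrable_mult_right Bochner_Integration.integrable_diff integrable_gauss)
    show "(s * x)\<^sup>2 * exp (- (s * x)\<^sup>2 / 2) \<le> 4 * (exp (- (s / 2 * x)\<^sup>2) - exp (- (s * x)\<^sup>2))" for x
      using ptw[of "(s * x)\<^sup>2"] by (simp add: power_divide)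
  qed
  also have "\<dots> = 4 * (gauss (s / 2) - gauss s)"
    using integrable_gauss[of s] integrable_gauss[of "s / 2"] by (simp add: gauss_def)
  finally show "(\<integral>x. (s * x)\<^sup>2 * exp (- (s * x)\<^sup>2 / 2) \<partial>F) \<le> 4 * (gauss (s / 2) - gauss s)" .
qed

lemma exp_self_norm_prod:
  "exp (- (s * self_norm X n \<omega>)\<^sup>2) = (\<Prod>i=1..n. exp (- (s * X i \<omega>)\<^sup>2))"
  unfolding power_mult_distrib self_norm_sq
  by (simp add: sum_distrib_left sum_negf exp_sum[symmetric])

lemma
  shows expectation_weight: "expectation (\<lambda>\<omega>. exp (- (s * self_norm X n \<omega>)\<^sup>2)) = gauss s ^ n"
    and integrable_weight: "integrable M (\<lambda>\<omega>. exp (- (s * self_norm X n \<omega>)\<^sup>2))"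
  unfolding exp_self_norm_prod gauss_def
  using expectation_prod_iid[of "\<lambda>_ x. exp (- (s * x)\<^sup>2)" "\<lambda>_. 1" n]
    integrable_prod_iid[of "\<lambda>_ x. exp (- (s * x)\<^sup>2)" "\<lambda>_. 1" n]
  by simp_all

text \<open>Only the product of \<open>u\<close> with the weight has to be bounded, so
  \<open>u\<close> may be a power of \<open>s x\<close>. All observations other than the
  \<open>i\<close>-th contribute a factor \<open>gauss s\<close>.\<close>

lemma
  fixes u :: "real \<Rightarrow> real"
  assumes [measurable]: "u \<in> borel_measurable borel"
    and bdd: "\<And>x. \<bar>u x * exp (- (s * x)\<^sup>2)\<bar> \<le> B" and i: "i \<in> {1..n}"
  shows expectation_weight_single:
      "expectation (\<lambda>\<omega>. u (X i \<omega>) * exp (- (s * self_norm X n \<omega>)\<^sup>2))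
        = (\<integral>x. u x * exp (- (s * x)\<^sup>2) \<partial>F) * gauss s ^ (n - 1)"
    and integrable_weight_single:
      "integrable M (\<lambda>\<omega>. u (X i \<omega>) * exp (- (s * self_norm X n \<omega>)\<^sup>2))"
proof -
  define f where "f = (\<lambda>j x. if j = i then u x * exp (- (s * x)\<^sup>2) else exp (- (s * x)\<^sup>2))"
  have f: "f j \<in> borel_measurable borel" "\<bar>f j x\<bar> \<le> max B 1" for j x
    using bdd[of x] by (auto simp: f_def le_max_iff_disj)
  have eq: "u (X i \<omega>) * exp (- (s * self_norm X n \<omega>)\<^sup>2) = (\<Prod>j=1..n. f j (X j \<omega>))" for \<omega>
  proof -
    have "(\<Prod>j=1..n. f j (X j \<omega>)) = (\<Prod>j=1..n. (if j = i then u (X j \<omega>) else 1) * exp (- (s * X j \<omega>)\<^sup>2))"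
      by (intro prod.cong) (auto simp: f_def)
    also have "\<dots> = u (X i \<omega>) * (\<Prod>j=1..n. exp (- (s * X j \<omega>)\<^sup>2))"
      using i by (simp add: prod.distrib)
    finally show ?thesis by (simp only: exp_self_norm_prod)
  qed
  show "integrable M (\<lambda>\<omega>. u (X i \<omega>) * exp (- (s * self_norm X n \<omega>)\<^sup>2))"
    unfolding eq by (rule integrable_prod_iid[OF f])
  have "(\<Prod>j=1..n. \<integral>x. f j x \<partial>F) = (\<integral>x. u x * exp (- (s * x)\<^sup>2) \<partial>F) * gauss s ^ (n - 1)"
  proof -
    have "(\<Prod>j=1..n. \<integral>x. f j x \<partial>F) = (\<integral>x. f i x \<partial>F) * (\<Prod>j\<in>{1..n} - {i}. \<integral>x. f j x \<partial>F)"
      using i by (intro prod.remove) auto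
    also have "(\<Prod>j\<in>{1..n} - {i}. \<integral>x. f j x \<partial>F) = (\<Prod>j\<in>{1..n} - {i}. gauss s)"
      by (intro prod.cong) (auto simp: f_def gauss_def)
    finally show ?thesis using i by (simp add: f_def)
  qed
  then show "expectation (\<lambda>\<omega>. u (X i \<omega>) * exp (- (s * self_norm X n \<omega>)\<^sup>2))
        = (\<integral>x. u x * exp (- (s * x)\<^sup>2) \<partial>F) * gauss s ^ (n - 1)"
    unfolding eq expectation_prod_iid[OF f] .
qed

lemma
  assumes ij: "i \<in> {1..n}" "j \<in> {1..n}" "i \<noteq> j"
  shows expectation_weight_pair:
      "expectation (\<lambda>\<omega>. (s * X i \<omega>) * (s * X j \<omega>) * exp (- (s * self_norm X n \<omega>)\<^sup>2)) \<le> (gauss1 s)\<^sup>2"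
    and integrable_weight_pair:
      "integrable M (\<lambda>\<omega>. (s * X i \<omega>) * (s * X j \<omega>) * exp (- (s * self_norm X n \<omega>)\<^sup>2))"
proof -
  define f where "f = (\<lambda>k x. if k \<in> {i, j} then s * x * exp (- (s * x)\<^sup>2) else exp (- (s * x)\<^sup>2))"
  have f: "f k \<in> borel_measurable borel" "\<bar>f k x\<bar> \<le> 1" for k x
    using abs_mult_exp_neg_square_le_1[of "s * x"] by (auto simp: f_def abs_mult)
  have eq: "(s * X i \<omega>) * (s * X j \<omega>) * exp (- (s * self_norm X n \<omega>)\<^sup>2) = (\<Prod>k=1..n. f k (X k \<omega>))" for \<omega>
  proof -
    have "(\<Prod>k=1..n. f k (X k \<omega>)) = (\<Prod>k=1..n. (if k = i then s * X k \<omega> else 1) *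
        (if k = j then s * X k \<omega> else 1) * exp (- (s * X k \<omega>)\<^sup>2))"
      using ij by (intro prod.cong) (auto simp: f_def)
    also have "\<dots> = (s * X i \<omega>) * (s * X j \<omega>) * (\<Prod>k=1..n. exp (- (s * X k \<omega>)\<^sup>2))"
      using ij by (simp add: prod.distrib)
    finally show ?thesis by (simp only: exp_self_norm_prod)
  qed
  show "integrable M (\<lambda>\<omega>. (s * X i \<omega>) * (s * X j \<omega>) * exp (- (s * self_norm X n \<omega>)\<^sup>2))"
    unfolding eq by (rule integrable_prod_iid[OF f])
  have "(\<Prod>k=1..n. \<integral>x. f k x \<partial>F) = (gauss1 s)\<^sup>2 * (\<Prod>k\<in>{1..n} - {i} - {j}. gauss s)"
  proof -
    have "(\<Prod>k=1..n. \<integral>x. f k x \<partial>F) = (\<integral>x. f i x \<partial>F) * (\<Prod>k\<in>{1..n} - {i}. \<integral>x. f k x \<partial>F)"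
      using ij by (intro prod.remove) auto
    also have "(\<Prod>k\<in>{1..n} - {i}. \<integral>x. f k x \<partial>F) = (\<integral>x. f j x \<partial>F) * (\<Prod>k\<in>{1..n} - {i} - {j}. \<integral>x. f k x \<partial>F)"
      using ij by (intro prod.remove) auto
    also have "(\<Prod>k\<in>{1..n} - {i} - {j}. \<integral>x. f k x \<partial>F) = (\<Prod>k\<in>{1..n} - {i} - {j}. gauss s)"
      by (intro prod.cong) (auto simp: f_def gauss_def)
    finally show ?thesis by (simp only: f_def gauss1_def power2_eq_square) simp
  qed
  also have "\<dots> \<le> (gauss1 s)\<^sup>2"
    using gauss_nonneg gauss_le_1 by (intro mult_left_le prod_le_1) auto
  finally show "expectation (\<lambda>\<omega>. (s * X i \<omega>) * (s * X j \<omega>) * exp (- (s * self_norm X n \<omega>)\<^sup>2)) \<le> (gauss1 s)\<^sup>2"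
    unfolding eq expectation_prod_iid[OF f] .
qed

text \<open>The exact value is recorded, with the power of \<open>gauss s\<close>, because it is
  later bounded from below.\<close>

lemma
  shows expectation_partial_sum_weight:
      "expectation (\<lambda>\<omega>. s * partial_sum X n \<omega> * exp (- (s * self_norm X n \<omega>)\<^sup>2))
        = real n * gauss1 s * gauss s ^ (n - 1)"
    and integrable_partial_sum_weight:
      "integrable M (\<lambda>\<omega>. s * partial_sum X n \<omega> * exp (- (s * self_norm X n \<omega>)\<^sup>2))"
proof -
  let ?w = "\<lambda>\<omega>. exp (- (s * self_norm X n \<omega>)\<^sup>2)"
  have eq: "s * partial_sum X n \<omega> * ?w \<omega> = (\<Sum>i=1..n. s * X i \<omega> * ?w \<omega>)" for \<omega>
    by (simp add: partial_sum_def sum_distrib_left sum_distrib_right)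
  have bdd: "\<bar>s * x * exp (- (s * x)\<^sup>2)\<bar> \<le> 1" for x
    using abs_mult_exp_neg_square_le_1[of "s * x"] by (simp add: abs_mult)
  note E = expectation_weight_single[of "\<lambda>x. s * x" s 1 _ n, OF _ bdd]
    and I = integrable_weight_single[of "\<lambda>x. s * x" s 1 _ n, OF _ bdd]
  show "integrable M (\<lambda>\<omega>. s * partial_sum X n \<omega> * ?w \<omega>)"
    unfolding eq by (intro Bochner_Integration.integrable_sum I) auto
  have "expectation (\<lambda>\<omega>. s * partial_sum X n \<omega> * ?w \<omega>) = (\<Sum>i=1..n. expectation (\<lambda>\<omega>. s * X i \<omega> * ?w \<omega>))"
    unfolding eq by (intro Bochner_Integration.integral_sum I) auto
  also have "\<dots> = (\<Sum>i=1..n. gauss1 s * gauss s ^ (n - 1))"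
    unfolding gauss1_def by (intro sum.cong refl E) auto
  finally show "expectation (\<lambda>\<omega>. s * partial_sum X n \<omega> * ?w \<omega>) = real n * gauss1 s * gauss s ^ (n - 1)"
    by simp
qed

text \<open>Only upper bounds are required here, so the powers of \<open>gauss s\<close> are
  estimated by 1. In the square of the sum, the diagonal produces \<open>gauss2\<close> and the
  pairs produce \<open>gauss1\<close> squared.\<close>

lemma
  shows expectation_self_norm_sq_weight:
      "expectation (\<lambda>\<omega>. (s * self_norm X n \<omega>)\<^sup>2 * exp (- (s * self_norm X n \<omega>)\<^sup>2)) \<le> real n * gauss2 s"
    and integrable_self_norm_sq_weight:
      "integrable M (\<lambda>\<omega>. (s * self_norm X n \<omega>)\<^sup>2 * exp (- (s * self_norm X n \<omega>)\<^sup>2))"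
    and expectation_partial_sum_sq_weight:
      "expectation (\<lambda>\<omega>. (s * partial_sum X n \<omega>)\<^sup>2 * exp (- (s * self_norm X n \<omega>)\<^sup>2))
        \<le> real n * gauss2 s + (real n * gauss1 s)\<^sup>2"
    and integrable_partial_sum_sq_weight:
      "integrable M (\<lambda>\<omega>. (s * partial_sum X n \<omega>)\<^sup>2 * exp (- (s * self_norm X n \<omega>)\<^sup>2))"
proof -
  let ?w = "\<lambda>\<omega>. exp (- (s * self_norm X n \<omega>)\<^sup>2)"
  have bdd: "\<bar>(s * x)\<^sup>2 * exp (- (s * x)\<^sup>2)\<bar> \<le> 1" for x
    using mult_exp_neg_le_1[of "(s * x)\<^sup>2"] by simp
  note E = expectation_weight_single[of "\<lambda>x. (s * x)\<^sup>2" s 1 _ n, OF _ bdd]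
    and I = integrable_weight_single[of "\<lambda>x. (s * x)\<^sup>2" s 1 _ n, OF _ bdd]
  have E_le: "expectation (\<lambda>\<omega>. (s * X i \<omega>)\<^sup>2 * ?w \<omega>) \<le> gauss2 s" if "i \<in> {1..n}" for i
  proof -
    have "expectation (\<lambda>\<omega>. (s * X i \<omega>)\<^sup>2 * ?w \<omega>) = gauss2 s * gauss s ^ (n - 1)"
      unfolding gauss2_def using that by (intro E) auto
    also have "\<dots> \<le> gauss2 s"
      using gauss2_nonneg gauss_nonneg gauss_le_1 by (intro mult_left_le power_le_one) auto
    finally show ?thesis .
  qed
  have eq: "(s * self_norm X n \<omega>)\<^sup>2 * ?w \<omega> = (\<Sum>i=1..n. (s * X i \<omega>)\<^sup>2 * ?w \<omega>)" for \<omega>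
  proof -
    have "(s * self_norm X n \<omega>)\<^sup>2 = (\<Sum>i=1..n. (s * X i \<omega>)\<^sup>2)"
      by (simp add: power_mult_distrib self_norm_sq sum_distrib_left)
    then show ?thesis by (simp only: sum_distrib_right)
  qed
  show "integrable M (\<lambda>\<omega>. (s * self_norm X n \<omega>)\<^sup>2 * ?w \<omega>)"
    unfolding eq by (intro Bochner_Integration.integrable_sum I) auto
  have "expectation (\<lambda>\<omega>. (s * self_norm X n \<omega>)\<^sup>2 * ?w \<omega>) = (\<Sum>i=1..n. expectation (\<lambda>\<omega>. (s * X i \<omega>)\<^sup>2 * ?w \<omega>))"
    unfolding eq by (intro Bochner_Integration.integral_sum I) auto
  also have "\<dots> \<le> (\<Sum>i=1..n. gauss2 s)"
    by (intro sum_mono E_le)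
  finally show "expectation (\<lambda>\<omega>. (s * self_norm X n \<omega>)\<^sup>2 * ?w \<omega>) \<le> real n * gauss2 s"
    by simp
  have eq2: "(s * partial_sum X n \<omega>)\<^sup>2 * ?w \<omega> = (\<Sum>i=1..n. \<Sum>j=1..n. (s * X i \<omega>) * (s * X j \<omega>) * ?w \<omega>)" for \<omega>
  proof -
    have "(s * partial_sum X n \<omega>)\<^sup>2 = (\<Sum>i=1..n. \<Sum>j=1..n. (s * X i \<omega>) * (s * X j \<omega>))"
    proof -
      have "s * partial_sum X n \<omega> = (\<Sum>i=1..n. s * X i \<omega>)"
        by (simp add: partial_sum_def sum_distrib_left)
      then show ?thesis by (simp only: power2_eq_square sum_product)
    qed
    then show ?thesis by (simp only: sum_distrib_right)
  qed
  have I2: "integrable M (\<lambda>\<omega>. (s * X i \<omega>) * (s * X j \<omega>) * ?w \<omega>)" if "i \<in> {1..n}" "j \<in> {1..n}" for i j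
  proof (cases "i = j")
    case True
    then show ?thesis using I[of i] that by (simp add: power2_eq_square)
  qed (intro integrable_weight_pair that)
  show "integrable M (\<lambda>\<omega>. (s * partial_sum X n \<omega>)\<^sup>2 * ?w \<omega>)"
    unfolding eq2 by (intro Bochner_Integration.integrable_sum I2)
  have "expectation (\<lambda>\<omega>. (s * partial_sum X n \<omega>)\<^sup>2 * ?w \<omega>)
      = (\<Sum>i=1..n. expectation (\<lambda>\<omega>. \<Sum>j=1..n. (s * X i \<omega>) * (s * X j \<omega>) * ?w \<omega>))"
    unfolding eq2 by (intro Bochner_Integration.integral_sum Bochner_Integration.integrable_sum I2)
  also have "\<dots> = (\<Sum>i=1..n. \<Sum>j=1..n. expectation (\<lambda>\<omega>. (s * X i \<omega>) * (s * X j \<omega>) * ?w \<omega>))"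
    by (intro sum.cong refl Bochner_Integration.integral_sum I2)
  also have "\<dots> \<le> (\<Sum>i=1..n. \<Sum>j=1..n. (if i = j then gauss2 s else 0) + (gauss1 s)\<^sup>2)"
  proof (intro sum_mono)
    fix i j assume ij: "i \<in> {1..n}" "j \<in> {1..n}"
    show "expectation (\<lambda>\<omega>. (s * X i \<omega>) * (s * X j \<omega>) * ?w \<omega>) \<le> (if i = j then gauss2 s else 0) + (gauss1 s)\<^sup>2"
    proof (cases "i = j")
      case True
      have "expectation (\<lambda>\<omega>. (s * X i \<omega>)\<^sup>2 * ?w \<omega>) \<le> gauss2 s + (gauss1 s)\<^sup>2"
        using E_le[OF ij(1)] by (rule order_trans) simp
      with True show ?thesis by (simp add: power2_eq_square)
    next
      case False
      then show ?thesis using expectation_weight_pair[OF ij False, of s] by simp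
    qed
  qed
  also have "\<dots> = real n * gauss2 s + (real n * gauss1 s)\<^sup>2"
    by (simp add: sum.distrib power2_eq_square algebra_simps)
  finally show "expectation (\<lambda>\<omega>. (s * partial_sum X n \<omega>)\<^sup>2 * ?w \<omega>) \<le> real n * gauss2 s + (real n * gauss1 s)\<^sup>2" .
qed

end

section \<open>From tightness to bounds on all even moments\<close>

lemma exp_half_le_2: "exp (1 / 2) \<le> (2 :: real)"
proof -
  have "(exp (1 / 2) :: real)\<^sup>2 = exp 1"
    by (simp add: exp_double[symmetric])
  also have "\<dots> \<le> 2\<^sup>2" using exp_le by simp
  finally show ?thesis by (rule power2_le_imp_le) simp
qed

context iid_sequence
begin

text \<open>The weighted mean of \<open>s S\<close> is known exactly and is compared with an upper
  bound. Where \<open>|S| \<le> a V\<close>, Cauchy-Schwarz gives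
  \<open>a * sqrt (n * gauss2 s)\<close>. The exceptional event, of probability at most 1/16,
  contributes at most a quarter of the root of the weighted second moment, and the part
  \<open>n * |gauss1 s|\<close> of that root is absorbed on the left. Taking \<open>n\<close> of
  order \<open>1 / h\<close> then gives the claim.\<close>

lemma gauss1_sq_le:
  assumes "a \<ge> 0" and "s \<ge> 0"
    and tight: "\<And>n. prob {\<omega>\<in>space M. \<bar>self_normalized_sum X n \<omega>\<bar> > a} \<le> 1 / 16"
  shows "(gauss1 s)\<^sup>2 \<le> 64 * (a + 1 / 4)\<^sup>2 * (1 - gauss s) * gauss2 s"
proof -
  define h where "h = 1 - gauss s"
  have "(1 / 4)\<^sup>2 \<le> (a + 1 / 4)\<^sup>2" using assms(1) by (intro power_mono) auto
  then have C: "64 * (a + 1 / 4)\<^sup>2 \<ge> 4" by (simp add: power2_eq_square)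
  have h0: "h \<ge> 0" using gauss_le_1[of s] by (simp add: h_def)
  \<comment> \<open>For \<open>h > 1/2\<close> the constant is large enough for the crude bound; for
    \<open>h = 0\<close> both \<open>gauss2\<close> and \<open>gauss1\<close> vanish. Only the third
    case uses tightness.\<close>
  consider "h > 1 / 2" | "h = 0" | "0 < h" "h \<le> 1 / 2" using h0 by force
  then show ?thesis
  proof cases
    case 1
    have "4 * (1 / 2) \<le> (64 * (a + 1 / 4)\<^sup>2) * h"
      using C 1 by (intro mult_mono) auto
    then have "1 \<le> (64 * (a + 1 / 4)\<^sup>2) * h" by linarith
    then have "1 * gauss2 s \<le> ((64 * (a + 1 / 4)\<^sup>2) * h) * gauss2 s"
      using gauss2_nonneg[of s] by (intro mult_right_mono) auto
    then show ?thesis using gauss1_sq_le_gauss2[of s] by (simp add: h_def)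
  next
    case 2
    then have "gauss2 s = 0" using gauss2_le[of s] gauss2_nonneg[of s] by (simp add: h_def)
    then show ?thesis using gauss1_sq_le_gauss2[of s] by simp
  next
    case 3
    text \<open>This sample size keeps the total mass \<open>(gauss s)\<^sup>n\<close> of the weight above \<open>1/2\<close>.\<close>
    define n where "n = nat \<lfloor>1 / (2 * h)\<rfloor>"
    have "1 \<le> 1 / (2 * h)" using 3 by (simp add: field_simps)
    then have fl: "1 \<le> \<lfloor>1 / (2 * h)\<rfloor>" by linarith
    then have n_eq: "real n = real_of_int \<lfloor>1 / (2 * h)\<rfloor>"
      unfolding n_def by (subst of_nat_nat) linarith+
    with fl have n1: "n \<ge> 1" by linarith
    have "real n \<le> 1 / (2 * h)" "1 / (2 * h) \<le> real n + 1" unfolding n_eq by linarith+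
    \<comment> \<open>The product \<open>n * h\<close> will lie between 1/4 and 1/2. The upper bound
      preserves the mass of the weight, the lower one finally replaces \<open>1 / n\<close> by a
      multiple of \<open>h\<close>.\<close>
    then have nh: "real n * h \<le> 1 / 2" and "1 / 2 \<le> (real n + 1) * h"
      using 3 by (simp_all add: field_simps)
    moreover have "(real n + 1) * h \<le> (2 * real n) * h"
      using 3 n1 by (intro mult_right_mono) auto
    ultimately have nh': "1 \<le> 4 * (real n * h)" by linarith
    have "1 + real n * (- h) \<le> (1 + (- h)) ^ n"
      using 3 by (intro Bernoulli_inequality) auto
    moreover have "1 + (- h) = gauss s" by (simp add: h_def)
    ultimately have "1 / 2 \<le> gauss s ^ n" using nh by simp
    also have "\<dots> \<le> gauss s ^ (n - 1)"
      using gauss_nonneg gauss_le_1 by (intro power_decreasing) auto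
    finally have pow: "1 / 2 \<le> gauss s ^ (n - 1)" .
    let ?V = "self_norm X n" and ?S = "partial_sum X n"
    let ?w = "\<lambda>\<omega>. exp (- (s * ?V \<omega>)\<^sup>2)"
    \<comment> \<open>The square root of the weight, to be shared between the factors in
      Cauchy-Schwarz.\<close>
    define v where "v = (\<lambda>\<omega>. exp (- (s * ?V \<omega>)\<^sup>2 / 2))"
    have [measurable]: "v \<in> borel_measurable M" by (simp add: v_def)
    have vv: "v \<omega> * v \<omega> = ?w \<omega>" for \<omega>
      by (simp add: v_def exp_add[symmetric])
    have v2: "(v \<omega>)\<^sup>2 = ?w \<omega>" for \<omega>
      by (simp add: power2_eq_square vv)
    define bad where "bad = {\<omega>\<in>space M. \<bar>self_normalized_sum X n \<omega>\<bar> > a}"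
    have [measurable]: "bad \<in> sets M" by (simp add: bad_def)
    have int_v: "integrable M (\<lambda>\<omega>. (v \<omega>)\<^sup>2)"
      using integrable_weight[of s n] by (simp add: v2)
    have int_Vv: "integrable M (\<lambda>\<omega>. (s * ?V \<omega> * v \<omega>)\<^sup>2)"
      using integrable_self_norm_sq_weight[of s n] by (simp add: power_mult_distrib[of _ "v _"] v2)
    have int_Sv: "integrable M (\<lambda>\<omega>. (s * \<bar>?S \<omega>\<bar> * v \<omega>)\<^sup>2)"
      using integrable_partial_sum_sq_weight[of s n]
      by (simp add: power_mult_distrib[of _ "v _"] power_mult_distrib[of s] v2)
    have int1: "integrable M (\<lambda>\<omega>. (s * ?V \<omega> * v \<omega>) * v \<omega>)"
      and CS1: "(expectation (\<lambda>\<omega>. (s * ?V \<omega> * v \<omega>) * v \<omega>))\<^sup>2 \<le>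
        expectation (\<lambda>\<omega>. (s * ?V \<omega> * v \<omega>)\<^sup>2) * expectation (\<lambda>\<omega>. (v \<omega>)\<^sup>2)"
      by (intro integrable_mult_of_square Cauchy_Schwarz_integral int_Vv int_v; measurable)+
    have E1: "expectation (\<lambda>\<omega>. (s * ?V \<omega> * v \<omega>) * v \<omega>) \<le> sqrt (real n * gauss2 s)"
    proof (rule real_le_rsqrt)
      note CS1
      also have "expectation (\<lambda>\<omega>. (s * ?V \<omega> * v \<omega>)\<^sup>2) * expectation (\<lambda>\<omega>. (v \<omega>)\<^sup>2)
          \<le> (real n * gauss2 s) * 1"
        using expectation_self_norm_sq_weight[of s n] expectation_weight[of s n] gauss2_nonneg[of s]
          gauss_nonneg[of s] gauss_le_1[of s]
        by (intro mult_mono) (auto simp: power_mult_distrib[of _ "v _"] v2 power_le_one)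
      finally show "(expectation (\<lambda>\<omega>. (s * ?V \<omega> * v \<omega>) * v \<omega>))\<^sup>2 \<le> real n * gauss2 s" by simp
    qed
    have int_v_bad: "integrable M (\<lambda>\<omega>. (v \<omega> * indicator bad \<omega>)\<^sup>2)"
      by (rule integrable_const_bound[where B = 1])
        (auto simp: power_mult_distrib v2 split: split_indicator)
    have int2: "integrable M (\<lambda>\<omega>. (s * \<bar>?S \<omega>\<bar> * v \<omega>) * (v \<omega> * indicator bad \<omega>))"
      and CS2: "(expectation (\<lambda>\<omega>. (s * \<bar>?S \<omega>\<bar> * v \<omega>) * (v \<omega> * indicator bad \<omega>)))\<^sup>2 \<le>
        expectation (\<lambda>\<omega>. (s * \<bar>?S \<omega>\<bar> * v \<omega>)\<^sup>2) * expectation (\<lambda>\<omega>. (v \<omega> * indicator bad \<omega>)\<^sup>2)"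
      by (intro integrable_mult_of_square Cauchy_Schwarz_integral int_Sv int_v_bad; measurable)+
    have E2: "expectation (\<lambda>\<omega>. (s * \<bar>?S \<omega>\<bar> * v \<omega>) * (v \<omega> * indicator bad \<omega>))
        \<le> 1 / 4 * (sqrt (real n * gauss2 s) + real n * \<bar>gauss1 s\<bar>)"
    proof -
      note CS2
      also have "expectation (\<lambda>\<omega>. (s * \<bar>?S \<omega>\<bar> * v \<omega>)\<^sup>2) * expectation (\<lambda>\<omega>. (v \<omega> * indicator bad \<omega>)\<^sup>2)
          \<le> (real n * gauss2 s + (real n * gauss1 s)\<^sup>2) * (1 / 16)"
      proof (intro mult_mono)
        show "expectation (\<lambda>\<omega>. (s * \<bar>?S \<omega>\<bar> * v \<omega>)\<^sup>2) \<le> real n * gauss2 s + (real n * gauss1 s)\<^sup>2"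
          using expectation_partial_sum_sq_weight[of s n]
          by (simp add: power_mult_distrib[of _ "v _"] power_mult_distrib[of s] v2)
        have "expectation (\<lambda>\<omega>. (v \<omega> * indicator bad \<omega>)\<^sup>2) \<le> expectation (indicator bad)"
          using int_v_bad
          by (intro integral_mono) (auto simp: power_mult_distrib v2 emeasure_eq_measure split: split_indicator)
        also have "\<dots> \<le> 1 / 16" using tight[of n] by (simp add: bad_def)
        finally show "expectation (\<lambda>\<omega>. (v \<omega> * indicator bad \<omega>)\<^sup>2) \<le> 1 / 16" .
      qed (auto simp: gauss2_nonneg)
      finally have "expectation (\<lambda>\<omega>. (s * \<bar>?S \<omega>\<bar> * v \<omega>) * (v \<omega> * indicator bad \<omega>))
          \<le> sqrt ((real n * gauss2 s + (real n * gauss1 s)\<^sup>2) * (1 / 16))"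
        by (rule real_le_rsqrt)
      also have "\<dots> = 1 / 4 * sqrt (real n * gauss2 s + (real n * gauss1 s)\<^sup>2)"
        by (simp add: real_sqrt_divide)
      also have "sqrt (real n * gauss2 s + (real n * gauss1 s)\<^sup>2)
          \<le> sqrt (real n * gauss2 s) + sqrt ((real n * gauss1 s)\<^sup>2)"
        using gauss2_nonneg[of s] by (intro sqrt_add_le_add_sqrt) auto
      finally show ?thesis by (simp add: abs_mult)
    qed
    \<comment> \<open>The weighted mean of \<open>s S\<close> is bounded below by its exact value,
      then above by splitting along \<open>bad\<close>.\<close>
    have "real n * \<bar>gauss1 s\<bar> * (1 / 2) \<le> real n * \<bar>gauss1 s\<bar> * gauss s ^ (n - 1)"
      using pow by (intro mult_left_mono) auto
    also have "\<dots> = \<bar>expectation (\<lambda>\<omega>. s * ?S \<omega> * ?w \<omega>)\<bar>"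
      using gauss_nonneg[of s] by (simp add: expectation_partial_sum_weight abs_mult)
    also have "\<dots> \<le> expectation (\<lambda>\<omega>. \<bar>s * ?S \<omega> * ?w \<omega>\<bar>)"
      by (rule integral_abs_bound)
    also have "\<dots> \<le> expectation (\<lambda>\<omega>. a * ((s * ?V \<omega> * v \<omega>) * v \<omega>) +
        (s * \<bar>?S \<omega>\<bar> * v \<omega>) * (v \<omega> * indicator bad \<omega>))"
    proof (intro integral_mono)
      fix \<omega> assume \<omega>: "\<omega> \<in> space M"
      show "\<bar>s * ?S \<omega> * ?w \<omega>\<bar> \<le> a * ((s * ?V \<omega> * v \<omega>) * v \<omega>) +
        (s * \<bar>?S \<omega>\<bar> * v \<omega>) * (v \<omega> * indicator bad \<omega>)"
      proof (cases "\<omega> \<in> bad")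
        case True
        have "0 \<le> a * (s * ?V \<omega> * ?w \<omega>)"
          using assms(1,2) self_norm_nonneg[of X n \<omega>] by simp
        then show ?thesis using True assms(2) by (simp add: abs_mult vv mult.assoc)
      next
        case False
        then have "\<bar>self_normalized_sum X n \<omega>\<bar> \<le> a" using \<omega> by (simp add: bad_def)
        then have "\<bar>?S \<omega>\<bar> \<le> a * ?V \<omega>"
          unfolding partial_sum_eq abs_mult using self_norm_nonneg[of X n \<omega>]
          by (intro mult_mono) auto
        then have "(s * ?w \<omega>) * \<bar>?S \<omega>\<bar> \<le> (s * ?w \<omega>) * (a * ?V \<omega>)"
          using assms(2) by (intro mult_left_mono) auto
        moreover have eq: "s * ?V \<omega> * v \<omega> * v \<omega> = s * ?V \<omega> * ?w \<omega>"
          by (simp add: mult.assoc vv)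
        ultimately show ?thesis unfolding eq using False assms(2) by (simp add: abs_mult mult_ac)
      qed
    qed (use integrable_partial_sum_weight int1 int2 in auto)
    also have "\<dots> = a * expectation (\<lambda>\<omega>. (s * ?V \<omega> * v \<omega>) * v \<omega>) +
        expectation (\<lambda>\<omega>. (s * \<bar>?S \<omega>\<bar> * v \<omega>) * (v \<omega> * indicator bad \<omega>))"
      using int1 int2 by (subst Bochner_Integration.integral_add) auto
    also have "\<dots> \<le> a * sqrt (real n * gauss2 s) + 1 / 4 * (sqrt (real n * gauss2 s) + real n * \<bar>gauss1 s\<bar>)"
      using E1 E2 assms(1) by (intro add_mono mult_left_mono) auto
    \<comment> \<open>A quarter of \<open>n * |gauss1 s|\<close> moves to the left, where a half of
      it stood.\<close>
    finally have "real n * \<bar>gauss1 s\<bar> \<le> 4 * (a + 1 / 4) * sqrt (real n * gauss2 s)"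
      by (simp add: algebra_simps)
    then have "(real n * \<bar>gauss1 s\<bar>)\<^sup>2 \<le> (4 * (a + 1 / 4) * sqrt (real n * gauss2 s))\<^sup>2"
      by (intro power_mono) auto
    also have "\<dots> = 16 * (a + 1 / 4)\<^sup>2 * (real n * gauss2 s)"
      unfolding power_mult_distrib using gauss2_nonneg[of s] by simp
    also have "\<dots> = real n * (16 * (a + 1 / 4)\<^sup>2 * gauss2 s)"
      by (simp only: mult_ac)
    also have "(real n * \<bar>gauss1 s\<bar>)\<^sup>2 = real n * (real n * (gauss1 s)\<^sup>2)"
      by (simp add: power_mult_distrib power2_eq_square)
    finally have "real n * (real n * (gauss1 s)\<^sup>2) \<le> real n * (16 * (a + 1 / 4)\<^sup>2 * gauss2 s)" .
    then have *: "real n * (gauss1 s)\<^sup>2 \<le> 16 * (a + 1 / 4)\<^sup>2 * gauss2 s"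
      using n1 by simp
    have "(gauss1 s)\<^sup>2 \<le> (4 * (real n * h)) * (gauss1 s)\<^sup>2"
      using nh' mult_right_mono[OF nh', of "(gauss1 s)\<^sup>2"] by simp
    also have "\<dots> = 4 * h * (real n * (gauss1 s)\<^sup>2)" by simp
    also have "\<dots> \<le> 4 * h * (16 * (a + 1 / 4)\<^sup>2 * gauss2 s)"
      using * h0 by (intro mult_left_mono) auto
    also have "\<dots> = 64 * (a + 1 / 4)\<^sup>2 * h * gauss2 s" by simp
    finally show ?thesis by (simp only: h_def)
  qed
qed

lemma
  shows expectation_exp_weight: "expectation (\<lambda>\<omega>. exp (b * (s * partial_sum X n \<omega>)) * exp (- (s * self_norm X n \<omega>)\<^sup>2))
      = (\<integral>x. exp (b * (s * x) - (s * x)\<^sup>2) \<partial>F) ^ n"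
    and integrable_exp_weight: "integrable M (\<lambda>\<omega>. exp (b * (s * partial_sum X n \<omega>)) * exp (- (s * self_norm X n \<omega>)\<^sup>2))"
    and integrable_F_exp: "integrable F (\<lambda>x. exp (b * (s * x) - (s * x)\<^sup>2))"
proof -
  let ?f = "\<lambda>x. exp (b * (s * x) - (s * x)\<^sup>2)"
  have bdd: "\<bar>?f x\<bar> \<le> exp (b\<^sup>2)" for x
  proof -
    have "b * (s * x) \<le> b\<^sup>2 + (s * x)\<^sup>2"
      using sum_squares_bound[of b "s * x"] zero_le_power2[of b] zero_le_power2[of "s * x"]
      by (cases "b * (s * x) \<ge> 0") linarith+
    then show ?thesis by simp
  qed
  have eq: "exp (b * (s * partial_sum X n \<omega>)) * exp (- (s * self_norm X n \<omega>)\<^sup>2) = (\<Prod>i=1..n. ?f (X i \<omega>))" for \<omega>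
    unfolding exp_self_norm_prod partial_sum_def
    by (simp add: sum_distrib_left exp_sum prod.distrib[symmetric] exp_add[symmetric])
  have "expectation (\<lambda>\<omega>. \<Prod>i=1..n. ?f (X i \<omega>)) = (\<Prod>i=1..n. \<integral>x. ?f x \<partial>F)"
    by (rule expectation_prod_iid[OF _ bdd]) simp
  then show "expectation (\<lambda>\<omega>. exp (b * (s * partial_sum X n \<omega>)) * exp (- (s * self_norm X n \<omega>)\<^sup>2))
      = (\<integral>x. ?f x \<partial>F) ^ n"
    unfolding eq by simp
  show "integrable M (\<lambda>\<omega>. exp (b * (s * partial_sum X n \<omega>)) * exp (- (s * self_norm X n \<omega>)\<^sup>2))"
    unfolding eq by (rule integrable_prod_iid[OF _ bdd]) simp
  show "integrable F ?f"
    by (rule integrable_F_bounded[OF _ bdd]) simp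
qed

text \<open>Second-order expansion in \<open>b\<close>: the remainder uses up half of the weight,
  and what is left is exactly the integrand of \<open>gauss_half_diff\<close>.\<close>

lemma integral_exp_le:
  assumes "\<bar>b\<bar> \<le> 1"
  shows "(\<integral>x. exp (b * (s * x) - (s * x)\<^sup>2) \<partial>F) \<le> gauss s + b * gauss1 s + 8 * b\<^sup>2 * (gauss (s / 2) - gauss s)"
proof -
  let ?k = "\<lambda>x. (s * x)\<^sup>2 * exp (- (s * x)\<^sup>2 / 2)"
  have ptw: "exp (b * y - y\<^sup>2) \<le> exp (- y\<^sup>2) + b * (y * exp (- y\<^sup>2)) + 2 * b\<^sup>2 * (y\<^sup>2 * exp (- y\<^sup>2 / 2))" for y :: real
  proof -
    have "exp (b * y) \<le> 1 + b * y + (b * y)\<^sup>2 * exp \<bar>b * y\<bar>"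
      using exp_minus_one_minus_self_le[of "b * y"] by linarith
    \<comment> \<open>For \<open>|b| \<le> 1\<close> the exponential of \<open>|b y|\<close> is at
      most \<open>exp (1 / 2 + y\<^sup>2 / 2)\<close>, so half of the weight outweighs it.\<close>
    also have "\<dots> \<le> 1 + b * y + (b * y)\<^sup>2 * (2 * exp (y\<^sup>2 / 2))"
    proof -
      have "\<bar>b * y\<bar> \<le> 1 * \<bar>y\<bar>"
        unfolding abs_mult using assms by (intro mult_right_mono) auto
      also have "\<dots> \<le> 1 / 2 + y\<^sup>2 / 2"
        using sum_squares_bound[of 1 "\<bar>y\<bar>"] by simp
      finally have "exp \<bar>b * y\<bar> \<le> exp (1 / 2 + y\<^sup>2 / 2)" by simp
      also have "\<dots> \<le> 2 * exp (y\<^sup>2 / 2)"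
        unfolding exp_add using exp_half_le_2 by (intro mult_right_mono) auto
      finally show ?thesis by (intro add_left_mono mult_left_mono) auto
    qed
    finally have "exp (- y\<^sup>2) * exp (b * y) \<le> exp (- y\<^sup>2) * (1 + b * y + (b * y)\<^sup>2 * (2 * exp (y\<^sup>2 / 2)))"
      by (intro mult_left_mono) auto
    also have "\<dots> = exp (- y\<^sup>2) + b * (y * exp (- y\<^sup>2)) + 2 * b\<^sup>2 * (y\<^sup>2 * (exp (- y\<^sup>2) * exp (y\<^sup>2 / 2)))"
      by (simp add: algebra_simps power_mult_distrib)
    also have "exp (- y\<^sup>2) * exp (y\<^sup>2 / 2) = exp (- y\<^sup>2 / 2)"
      by (simp add: exp_add[symmetric])
    also have "exp (- y\<^sup>2) * exp (b * y) = exp (b * y - y\<^sup>2)"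
      by (simp add: exp_add[symmetric])
    finally show ?thesis .
  qed
  have "(\<integral>x. exp (b * (s * x) - (s * x)\<^sup>2) \<partial>F)
      \<le> (\<integral>x. exp (- (s * x)\<^sup>2) + b * (s * x * exp (- (s * x)\<^sup>2)) + 2 * b\<^sup>2 * ?k x \<partial>F)"
    using ptw by (intro integral_mono integrable_F_exp Bochner_Integration.integrable_add
        Bochner_Integration.integrable_mult_right integrable_gauss integrable_gauss1 integrable_gauss_half)
  also have "\<dots> = gauss s + b * gauss1 s + 2 * b\<^sup>2 * (\<integral>x. ?k x \<partial>F)"
    using integrable_gauss[of s] integrable_gauss1[of s] integrable_gauss_half[of s]
    by (simp add: gauss_def gauss1_def)
  also have "\<dots> \<le> gauss s + b * gauss1 s + 2 * b\<^sup>2 * (4 * (gauss (s / 2) - gauss s))"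
    by (intro add_left_mono mult_left_mono gauss_half_diff) auto
  finally show ?thesis by (simp add: algebra_simps)
qed

lemma gauss2_le_half_diff: "gauss2 s \<le> 4 * (gauss (s / 2) - gauss s)"
proof -
  have "gauss2 s \<le> (\<integral>x. (s * x)\<^sup>2 * exp (- (s * x)\<^sup>2 / 2) \<partial>F)"
    unfolding gauss2_def by (intro integral_mono integrable_gauss2 integrable_gauss_half mult_left_mono) auto
  also have "\<dots> \<le> 4 * (gauss (s / 2) - gauss s)"
    by (rule gauss_half_diff)
  finally show ?thesis .
qed

text \<open>The \<open>cosh\<close> averages the parameters \<open>b\<close> and \<open>-b\<close>,
  so the terms linear in \<open>gauss1\<close> cancel. The quadratic ones carry a factor
  \<open>gauss (s / 2) - gauss s\<close>, by \<open>gauss1_sq_le\<close>. The bound is written as a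
  difference between scales \<open>s / 2\<close> and \<open>s\<close> so that it telescopes.\<close>

lemma expectation_cosh_weight_le:
  assumes "a \<ge> 0" and "s \<ge> 0" and "n \<ge> 2"
    and tight: "\<And>n. prob {\<omega>\<in>space M. \<bar>self_normalized_sum X n \<omega>\<bar> > a} \<le> 1 / 16"
  defines "b \<equiv> 1 / (64 * a + 16)"
  shows "expectation (\<lambda>\<omega>. (cosh (b * (s * partial_sum X n \<omega>)) - 1) * exp (- (s * self_norm X n \<omega>)\<^sup>2))
    \<le> 4 * (exp (- (real n * (1 - gauss (s / 2)) / 4)) - exp (- (real n * (1 - gauss s) / 4)))" (is "?E \<le> _")
    and "integrable M (\<lambda>\<omega>. (cosh (b * (s * partial_sum X n \<omega>)) - 1) * exp (- (s * self_norm X n \<omega>)\<^sup>2))"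
proof -
  let ?w = "\<lambda>\<omega>. exp (- (s * self_norm X n \<omega>)\<^sup>2)"
  define h \<Delta> where "h = 1 - gauss s" and "\<Delta> = gauss (s / 2) - gauss s"
  define G1 G2 where "G1 = (\<integral>x. exp (b * (s * x) - (s * x)\<^sup>2) \<partial>F)"
    and "G2 = (\<integral>x. exp ((- b) * (s * x) - (s * x)\<^sup>2) \<partial>F)"
  have b: "0 < b" "b \<le> 1 / 16" using assms(1) by (auto simp: b_def field_simps)
  have h: "0 \<le> h" "h \<le> 1" using gauss_le_1[of s] gauss_nonneg[of s] by (auto simp: h_def)
  have \<Delta>0: "0 \<le> \<Delta>" using gauss2_le_half_diff[of s] gauss2_nonneg[of s] by (simp add: \<Delta>_def)
  have \<Delta>h: "\<Delta> \<le> h" using gauss_le_1[of "s / 2"] by (simp add: h_def \<Delta>_def)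
  have b2: "8 * b\<^sup>2 \<le> 1 / 32"
    using power_mono[of b "1 / 16" 2] b by (simp add: power2_eq_square)
  define B where "B = b * \<bar>gauss1 s\<bar>"
  define P where "P = gauss s + 8 * b\<^sup>2 * \<Delta>"
  \<comment> \<open>The value of \<open>b\<close> makes
    \<open>b\<^sup>2 * 64 * (a + 1 / 4)\<^sup>2 * 4\<close> equal to 1/16.\<close>
  have B2: "B\<^sup>2 \<le> 1 / 16 * (h * \<Delta>)"
  proof -
    have "B\<^sup>2 = b\<^sup>2 * (gauss1 s)\<^sup>2" by (simp add: B_def power_mult_distrib)
    also have "\<dots> \<le> b\<^sup>2 * (64 * (a + 1 / 4)\<^sup>2 * h * gauss2 s)"
      unfolding h_def by (intro mult_left_mono gauss1_sq_le assms) auto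
    also have "\<dots> \<le> b\<^sup>2 * (64 * (a + 1 / 4)\<^sup>2 * h * (4 * \<Delta>))"
      unfolding \<Delta>_def using h by (intro mult_left_mono gauss2_le_half_diff) auto
    also have "\<dots> = (b * (64 * a + 16))\<^sup>2 / 16 * (h * \<Delta>)"
      by (simp add: power2_eq_square field_simps)
    also have "b * (64 * a + 16) = 1" using assms(1) by (simp add: b_def)
    finally show ?thesis by simp
  qed
  also have "\<dots> \<le> 1 / 16 * (h * h)"
    using \<Delta>h h by (intro mult_left_mono) auto
  also have "\<dots> = (h / 4)\<^sup>2" by (simp add: power2_eq_square)
  finally have Bh: "B \<le> h / 4" using h by (rule_tac power2_le_imp_le) auto
  have B0: "B \<ge> 0" using b by (simp add: B_def)
  have G_nonneg: "0 \<le> G1" "0 \<le> G2" by (simp_all add: G1_def G2_def)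
  have G1: "G1 \<le> P + b * gauss1 s"
    using integral_exp_le[of b s] b by (simp add: G1_def P_def \<Delta>_def)
  have G2: "G2 \<le> P - b * gauss1 s"
    using integral_exp_le[of "- b" s] b by (simp add: G2_def P_def \<Delta>_def)
  \<comment> \<open>The smaller of the two upper bounds is \<open>P - B\<close>, and it dominates a
    nonnegative integral.\<close>
  have BP: "B \<le> P"
    using G1 G2 G_nonneg by (cases "gauss1 s \<ge> 0") (auto simp: B_def)
  \<comment> \<open>Of the deficit \<open>h\<close> in \<open>gauss s\<close>, the corrections use
    up at most \<open>h / 32\<close> and \<open>h / 4\<close>, so more than half remains.\<close>
  have PB: "P + B \<le> exp (- h / 2)"
  proof -
    have "8 * b\<^sup>2 * \<Delta> \<le> 1 / 32 * h"
      using b2 \<Delta>h \<Delta>0 by (intro mult_mono) auto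
    then have "P + B \<le> 1 + (- h / 2)"
      using Bh h h_def unfolding P_def by linarith
    also have "\<dots> \<le> exp (- h / 2)" by (rule exp_ge_add_one_self)
    finally show ?thesis .
  qed
  \<comment> \<open>Omitting up to two factors costs at most \<open>exp h \<le> 3\<close>.\<close>
  have pow_le: "(P + B) ^ (n - k) \<le> 3 * exp (- (real n * h / 2))" if "k \<le> 2" for k
  proof -
    have "(P + B) ^ (n - k) \<le> exp (- h / 2) ^ (n - k)"
      using PB BP B0 by (intro power_mono) auto
    also have "\<dots> = exp (real (n - k) * (- h / 2))"
      by (rule exp_of_nat_mult[symmetric])
    also have "real (n - k) * (- h / 2) = real k * h / 2 + (- (real n * h / 2))"
      using that assms(3) by (simp add: of_nat_diff field_simps)
    also have "exp \<dots> = exp (real k * h / 2) * exp (- (real n * h / 2))"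
      by (rule exp_add)
    also have "\<dots> \<le> 3 * exp (- (real n * h / 2))"
    proof (intro mult_right_mono)
      have "real k * h / 2 \<le> 2 * 1 / 2"
        using that h by (intro divide_right_mono mult_mono) auto
      then have "exp (real k * h / 2) \<le> exp 1" by simp
      also have "\<dots> \<le> 3" by (rule exp_le)
      finally show "exp (real k * h / 2) \<le> 3" .
    qed simp
    finally show ?thesis .
  qed
  obtain m where m: "n = m + 2" using assms(3) by (metis add.commute le_Suc_ex)
  \<comment> \<open>Whatever the sign of \<open>gauss1 s\<close>, the two bases are
    \<open>P + B\<close> and \<open>P - B\<close>, so the second difference estimate
    applies.\<close>
  have "G1 ^ n + G2 ^ n \<le> (P + b * gauss1 s) ^ n + (P - b * gauss1 s) ^ n"
    using G1 G2 G_nonneg by (intro add_mono power_mono) auto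
  also have "\<dots> = (P + B) ^ n + (P - B) ^ n"
    by (cases "gauss1 s \<ge> 0") (simp_all add: B_def)
  also have "\<dots> \<le> 2 * P ^ n + (real n)\<^sup>2 * B\<^sup>2 * (P + B) ^ (n - 2)"
    using power_add_power_diff_le[OF B0 BP, of m] by (simp add: m)
  finally have "G1 ^ n + G2 ^ n - 2 * gauss s ^ n
      \<le> (real n)\<^sup>2 * B\<^sup>2 * (P + B) ^ (n - 2) + 2 * (P ^ n - gauss s ^ n)" by simp
  also have "P ^ n - gauss s ^ n \<le> real n * (8 * b\<^sup>2 * \<Delta>) * P ^ (n - 1)"
    using power_diff_le[of "gauss s" P "m + 1"] gauss_nonneg \<Delta>0 by (simp add: m P_def)
  also have "\<dots> \<le> real n * (1 / 32 * \<Delta>) * (P + B) ^ (n - 1)"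
    using b2 \<Delta>0 B0 BP by (intro mult_mono power_mono) auto
  also have "(real n)\<^sup>2 * B\<^sup>2 * (P + B) ^ (n - 2) + 2 * (real n * (1 / 32 * \<Delta>) * (P + B) ^ (n - 1))
      \<le> (real n)\<^sup>2 * (1 / 16 * (h * \<Delta>)) * (3 * exp (- (real n * h / 2)))
        + 2 * (real n * (1 / 32 * \<Delta>) * (3 * exp (- (real n * h / 2))))"
    using B2 \<Delta>0 B0 BP h pow_le[of 1] pow_le[of 2]
    by (intro add_mono mult_mono mult_left_mono) auto
  also have "\<dots> = 3 / 16 * (real n * \<Delta>) * ((real n * h + 1) * exp (- (real n * h / 2)))"
    by (simp add: power2_eq_square algebra_simps)
  \<comment> \<open>Half of the exponential decay absorbs the linear factor
    \<open>n h + 1\<close>.\<close>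
  also have "\<dots> \<le> 3 / 16 * (real n * \<Delta>) * (5 * exp (- (real n * h / 4)))"
  proof (intro mult_left_mono)
    define u where "u = real n * h / 4"
    have "u \<ge> 0" using h by (simp add: u_def)
    have "(4 * u + 1) * exp (- (2 * u)) = (4 * (u * exp (- u)) + exp (- u)) * exp (- u)"
      by (simp add: algebra_simps exp_add[symmetric])
    also have "\<dots> \<le> 5 * exp (- u)"
      using mult_exp_neg_le_1[of u] \<open>u \<ge> 0\<close> by (intro mult_right_mono) (auto intro: add_mono[of _ 4 _ 1, simplified])
    finally show "(real n * h + 1) * exp (- (real n * h / 2)) \<le> 5 * exp (- (real n * h / 4))"
      by (simp add: u_def mult.commute)
  qed (use \<Delta>0 in auto)
  also have "\<dots> \<le> 2 * (real n * \<Delta> * exp (- (real n * h / 4)))"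
    using \<Delta>0 by simp
  \<comment> \<open>The bound \<open>1 + x \<le> exp x\<close> at \<open>x = n \<Delta> / 4\<close>
    moves the exponent from scale \<open>s\<close> to scale \<open>s / 2\<close>.\<close>
  also have "real n * \<Delta> * exp (- (real n * h / 4)) \<le>
      4 * (exp (- (real n * (1 - gauss (s / 2)) / 4)) - exp (- (real n * h / 4)))"
  proof -
    have "(1 + real n * \<Delta> / 4) * exp (- (real n * h / 4)) \<le> exp (real n * \<Delta> / 4) * exp (- (real n * h / 4))"
      by (intro mult_right_mono exp_ge_add_one_self) auto
    also have "\<dots> = exp (- (real n * (1 - gauss (s / 2)) / 4))"
      unfolding exp_add[symmetric] by (simp add: h_def \<Delta>_def field_simps)
    finally show ?thesis by (simp add: algebra_simps)
  qed
  finally have main: "G1 ^ n + G2 ^ n - 2 * gauss s ^ n \<le>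
      2 * (4 * (exp (- (real n * (1 - gauss (s / 2)) / 4)) - exp (- (real n * h / 4))))" by simp
  let ?e = "\<lambda>c \<omega>. exp (c * (s * partial_sum X n \<omega>)) * ?w \<omega>"
  have eq: "(cosh (b * (s * partial_sum X n \<omega>)) - 1) * ?w \<omega> = (?e b \<omega> + ?e (- b) \<omega> - 2 * ?w \<omega>) / 2" for \<omega>
    by (simp add: cosh_def field_simps)
  show "integrable M (\<lambda>\<omega>. (cosh (b * (s * partial_sum X n \<omega>)) - 1) * ?w \<omega>)"
    unfolding eq by (intro Bochner_Integration.integrable_divide Bochner_Integration.integrable_diff
        Bochner_Integration.integrable_add Bochner_Integration.integrable_mult_right integrable_exp_weight integrable_weight)
  have "?E = (G1 ^ n + G2 ^ n - 2 * gauss s ^ n) / 2"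
    unfolding eq G1_def G2_def expectation_exp_weight[symmetric] expectation_weight[symmetric]
    using integrable_exp_weight[of b s n] integrable_exp_weight[of "- b" s n] integrable_weight[of s n]
    by simp
  with main show "?E \<le> 4 * (exp (- (real n * (1 - gauss (s / 2)) / 4)) - exp (- (real n * (1 - gauss s) / 4)))"
    by (simp add: h_def)
qed

text \<open>Finitely many dyadic scales suffice while the norm is confined to a compact range of
  positive values. The telescoped bound does not depend on the range, and Fatou's lemma removes the
  confinement.\<close>

lemma self_normalized_sum_moment_bounded:
  assumes "a \<ge> 0" and "q \<ge> 1"
    and tight: "\<And>n. prob {\<omega>\<in>space M. \<bar>self_normalized_sum X n \<omega>\<bar> > a} \<le> 1 / 16"
  obtains C where "C \<ge> 0"
    and "\<And>n. n \<ge> 2 \<Longrightarrow> (\<integral>\<^sup>+\<omega>. ennreal (self_normalized_sum X n \<omega> ^ (2 * q)) \<partial>M) \<le> ennreal C"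
proof
  define b where "b = 1 / (64 * a + 16)"
  have b: "b > 0" using assms(1) by (auto simp: b_def intro!: divide_pos_pos)
  define c where "c = exp 4 * fact (2 * q) / b ^ (2 * q)"
  have c0: "c \<ge> 0" using b by (simp add: c_def)
  show "4 * c \<ge> 0" using c0 by simp
  fix n :: nat assume n: "n \<ge> 2"
  let ?Q = "self_normalized_sum X n" and ?S = "partial_sum X n" and ?V = "self_norm X n"
  let ?e = "\<lambda>s \<omega>. (cosh (b * (s * ?S \<omega>)) - 1) * exp (- (s * ?V \<omega>)\<^sup>2)"
  define A where "A = (\<lambda>K::nat. {\<omega>. 1 \<le> 2 ^ K * ?V \<omega> \<and> ?V \<omega> \<le> 2 ^ K})"
  have e0: "0 \<le> ?e s \<omega>" for s \<omega>
    using cosh_real_ge_1[of "b * (s * ?S \<omega>)"] by simp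
  \<comment> \<open>At a scale with \<open>1 \<le> s V \<le> 2\<close>, the statistic is at most
    \<open>|s S|\<close> and the weight at least \<open>exp (-4)\<close>, which explains the
    constant \<open>c\<close>.\<close>
  have Q_le: "?Q \<omega> ^ (2 * q) \<le> c * ?e s \<omega>" if s: "s \<ge> 0" "1 \<le> s * ?V \<omega>" "s * ?V \<omega> \<le> 2" for s \<omega>
  proof -
    have "\<bar>?Q \<omega>\<bar> * 1 \<le> \<bar>?Q \<omega>\<bar> * (s * ?V \<omega>)"
      using s by (intro mult_left_mono) auto
    also have "\<dots> = \<bar>s * ?S \<omega>\<bar>"
      unfolding partial_sum_eq using s self_norm_nonneg[of X n \<omega>] by (simp add: abs_mult)
    finally have "\<bar>?Q \<omega>\<bar> ^ (2 * q) \<le> \<bar>s * ?S \<omega>\<bar> ^ (2 * q)"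
      by (intro power_mono) auto
    then have "?Q \<omega> ^ (2 * q) \<le> (s * ?S \<omega>) ^ (2 * q)"
      by (simp add: power_even_abs)
    also have "\<dots> = (b * (s * ?S \<omega>)) ^ (2 * q) / b ^ (2 * q)"
      using b by (simp add: power_mult_distrib)
    also have "\<dots> \<le> fact (2 * q) * (cosh (b * (s * ?S \<omega>)) - 1) / b ^ (2 * q)"
      using b by (intro divide_right_mono even_power_le_cosh assms) auto
    also have "\<dots> \<le> (fact (2 * q) * (cosh (b * (s * ?S \<omega>)) - 1) / b ^ (2 * q)) * (exp 4 * exp (- (s * ?V \<omega>)\<^sup>2))"
    proof -
      have "(s * ?V \<omega>)\<^sup>2 \<le> 2\<^sup>2" using s by (intro power_mono) auto
      then have "1 \<le> exp (4 + (- (s * ?V \<omega>)\<^sup>2))" by simp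
      then have "1 \<le> exp 4 * exp (- (s * ?V \<omega>)\<^sup>2)" unfolding exp_add .
      moreover have "0 \<le> fact (2 * q) * (cosh (b * (s * ?S \<omega>)) - 1) / b ^ (2 * q)"
        using b cosh_real_ge_1[of "b * (s * ?S \<omega>)"] by simp
      ultimately show ?thesis by (metis mult_left_mono mult.right_neutral)
    qed
    also have "\<dots> = c * ?e s \<omega>" by (simp add: c_def)
    finally show ?thesis .
  qed
  have bound: "(\<integral>\<^sup>+\<omega>. ennreal (?Q \<omega> ^ (2 * q)) * indicator (A K) \<omega> \<partial>M) \<le> ennreal (4 * c)" for K
  proof -
    define \<sigma> where "\<sigma> = (\<lambda>k::nat. 2 ^ k / 2 ^ K :: real)"
    have ptw: "?Q \<omega> ^ (2 * q) \<le> c * (\<Sum>k\<le>2 * K. ?e (\<sigma> k) \<omega>)" if \<omega>: "\<omega> \<in> A K" for \<omega>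
    proof -
      let ?P = "\<lambda>k. 1 \<le> \<sigma> k * ?V \<omega>"
      have "?P (2 * K)" using \<omega> by (simp add: A_def \<sigma>_def mult_2 power_add)
      \<comment> \<open>The first scale with \<open>s V \<ge> 1\<close> also has
        \<open>s V \<le> 2\<close>: the preceding scale is half as large, and at
        \<open>k = 0\<close> the bound on the norm from above applies.\<close>
      then obtain k where k: "k \<le> 2 * K" "?P k" "\<And>i. i < k \<Longrightarrow> \<not> ?P i"
        using ex_least_nat_le[of ?P "2 * K"] by blast
      have "\<sigma> k * ?V \<omega> \<le> 2"
      proof (cases k)
        case 0
        have "?V \<omega> \<le> 2 ^ K" "(0::real) \<le> 2 ^ K" using \<omega> by (simp_all add: A_def)
        then have "?V \<omega> \<le> 2 * 2 ^ K" by linarith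
        then show ?thesis using 0 by (simp add: \<sigma>_def divide_le_eq)
      next
        case (Suc j)
        then have "\<sigma> j * ?V \<omega> < 1" using k(3)[of j] by simp
        moreover have "\<sigma> k * ?V \<omega> = 2 * (\<sigma> j * ?V \<omega>)" by (simp add: Suc \<sigma>_def)
        ultimately show ?thesis by linarith
      qed
      then have "?Q \<omega> ^ (2 * q) \<le> c * ?e (\<sigma> k) \<omega>"
        using k(2) by (intro Q_le) (auto simp: \<sigma>_def)
      also have "\<dots> \<le> c * (\<Sum>k\<le>2 * K. ?e (\<sigma> k) \<omega>)"
        using k(1) e0 c0 by (intro mult_left_mono member_le_sum) auto
      finally show ?thesis .
    qed
    have int: "integrable M (?e (\<sigma> k))" for k
      unfolding b_def by (intro expectation_cosh_weight_le(2) assms n) (simp add: \<sigma>_def)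
    \<comment> \<open>As \<open>\<sigma> (Suc k) / 2 = \<sigma> k\<close>, the bounds at consecutive
      scales are differences of consecutive values of \<open>f\<close>, all between 0 and 1.\<close>
    define f where "f = (\<lambda>k. exp (- (real n * (1 - gauss (\<sigma> k / 2)) / 4)))"
    have "expectation (\<lambda>\<omega>. \<Sum>k\<le>2 * K. ?e (\<sigma> k) \<omega>) = (\<Sum>k\<le>2 * K. expectation (?e (\<sigma> k)))"
      by (intro Bochner_Integration.integral_sum int)
    also have "\<dots> \<le> (\<Sum>k\<le>2 * K. 4 * (f k - f (Suc k)))"
    proof (intro sum_mono)
      fix k
      have "\<sigma> (Suc k) / 2 = \<sigma> k" by (simp add: \<sigma>_def)
      then show "expectation (?e (\<sigma> k)) \<le> 4 * (f k - f (Suc k))"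
        unfolding f_def b_def
        using expectation_cosh_weight_le(1)[OF assms(1) _ n tight, of "\<sigma> k"] by (simp add: \<sigma>_def)
    qed
    also have "\<dots> = 4 * (f 0 - f (Suc (2 * K)))"
      unfolding sum_distrib_left[symmetric] by (simp add: sum_telescope)
    also have "\<dots> \<le> 4 * (1 - 0)"
      using gauss_le_1[of "\<sigma> 0 / 2"] by (intro mult_left_mono diff_mono) (auto simp: f_def)
    finally have E: "expectation (\<lambda>\<omega>. \<Sum>k\<le>2 * K. ?e (\<sigma> k) \<omega>) \<le> 4" by simp
    have "(\<integral>\<^sup>+\<omega>. ennreal (?Q \<omega> ^ (2 * q)) * indicator (A K) \<omega> \<partial>M)
        \<le> (\<integral>\<^sup>+\<omega>. ennreal (c * (\<Sum>k\<le>2 * K. ?e (\<sigma> k) \<omega>)) \<partial>M)"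
      using ptw by (intro nn_integral_mono) (auto intro!: ennreal_leI split: split_indicator)
    also have "\<dots> = ennreal (expectation (\<lambda>\<omega>. c * (\<Sum>k\<le>2 * K. ?e (\<sigma> k) \<omega>)))"
      using int c0 e0
      by (intro nn_integral_eq_integral Bochner_Integration.integrable_mult_right
          Bochner_Integration.integrable_sum AE_I2 mult_nonneg_nonneg[OF c0] sum_nonneg)
    also have "\<dots> = ennreal (c * expectation (\<lambda>\<omega>. \<Sum>k\<le>2 * K. ?e (\<sigma> k) \<omega>))"
      by (subst integral_mult_right_zero) simp
    also have "\<dots> \<le> ennreal (4 * c)"
      using mult_left_mono[OF E c0] by (intro ennreal_leI) (simp add: mult.commute)
    finally show ?thesis .
  qed
  have "(\<integral>\<^sup>+\<omega>. ennreal (?Q \<omega> ^ (2 * q)) \<partial>M)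
      \<le> (\<integral>\<^sup>+\<omega>. liminf (\<lambda>K. ennreal (?Q \<omega> ^ (2 * q)) * indicator (A K) \<omega>) \<partial>M)"
  proof (intro nn_integral_mono)
    fix \<omega>
    show "ennreal (?Q \<omega> ^ (2 * q)) \<le> liminf (\<lambda>K. ennreal (?Q \<omega> ^ (2 * q)) * indicator (A K) \<omega>)"
    proof (cases "?V \<omega> = 0")
      case True
      then show ?thesis using assms(2) by (simp add: self_normalized_sum_def power_0_left)
    next
      case False
      then have V: "?V \<omega> > 0" using self_norm_nonneg[of X n \<omega>] by simp
      have lim: "filterlim (\<lambda>K. 2 ^ K :: real) at_top sequentially"
        by real_asymp
      have "\<forall>\<^sub>F K in sequentially. 1 / ?V \<omega> \<le> 2 ^ K" "\<forall>\<^sub>F K in sequentially. ?V \<omega> \<le> 2 ^ K"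
        using lim unfolding filterlim_at_top by blast+
      then have "\<forall>\<^sub>F K in sequentially. \<omega> \<in> A K"
        by eventually_elim (use V in \<open>simp add: A_def field_simps\<close>)
      then have "(\<lambda>K. ennreal (?Q \<omega> ^ (2 * q)) * indicator (A K) \<omega>) \<longlonglongrightarrow> ennreal (?Q \<omega> ^ (2 * q))"
        by (intro tendsto_eventually) (auto elim: eventually_mono)
      then show ?thesis by (simp add: lim_imp_Liminf)
    qed
  qed
  also have "\<dots> \<le> liminf (\<lambda>K. \<integral>\<^sup>+\<omega>. ennreal (?Q \<omega> ^ (2 * q)) * indicator (A K) \<omega> \<partial>M)"
    unfolding A_def by (intro nn_integral_liminf) measurable
  also have "\<dots> \<le> liminf (\<lambda>K::nat. ennreal (4 * c))"
    by (intro Liminf_mono always_eventually allI bound)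
  also have "\<dots> = ennreal (4 * c)"
    by (simp add: Liminf_const)
  finally show "(\<integral>\<^sup>+\<omega>. ennreal (?Q \<omega> ^ (2 * q)) \<partial>M) \<le> ennreal (4 * c)" .
qed

section \<open>Moments of the t-statistic on the event of a large self-normalized sum\<close>

text \<open>An exponential Markov bound: each bad block that misses the window receives the weight
  8. On the event, these weights multiply to at least \<open>4 ^ N\<close> up to a constant, as at
  most \<open>n0\<close> blocks meet the window. By independence each block contributes at most
  \<open>1 + 7/16 = 23/16\<close> in the mean, and division by 4 leaves
  \<open>23/64\<close>.\<close>

lemma window_moment_large_self_normalized_sum:
  assumes a: "a \<ge> 0" "a\<^sup>2 \<le> real m / 4" "m > 0"
    and bad: "prob {\<omega>\<in>space M. \<bar>self_normalized_sum X m \<omega>\<bar> > a} \<le> 1 / 16"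
    and n0: "n0 \<ge> 1"
    and [measurable]: "g \<in> borel_measurable borel"
  shows "(\<integral>\<^sup>+\<omega>. ennreal (g (t_statistic (\<lambda>j. X (i + j)) n0 \<omega>)) *
      indicator {\<omega>. (self_normalized_sum X n \<omega>)\<^sup>2 > 3 / 4 * real n} \<omega> \<partial>M)
    \<le> ennreal (2 ^ (4 + 3 * n0) * (23 / 64) ^ (n div m)) * (\<integral>\<^sup>+\<omega>. ennreal (g (t_statistic X n0 \<omega>)) \<partial>M)"
proof -
  define N where "N = n div m"
  define B where "B = {i + 1..i + n0}"
  define K where "K = (\<lambda>j. {j * m + 1..j * m + m})"
  define J where "J = {j. j < N \<and> K j \<inter> B = {}}"
  let ?bad = "\<lambda>j \<omega>. \<bar>self_normalized_sum (\<lambda>i. X (j * m + i)) m \<omega>\<bar> > a"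
  define Z where "Z = (\<lambda>\<omega>. \<Prod>j\<in>J. if ?bad j \<omega> then 8 else 1 :: ennreal)"
  let ?G = "\<lambda>\<omega>. ennreal (g (t_statistic (\<lambda>j. X (i + j)) n0 \<omega>))"
  have K_div: "(b - 1) div m = j" if "b \<in> K j" for b j
  proof -
    define d where "d = b - 1 - j * m"
    have "b - 1 = j * m + d" "d < m"
      using that by (auto simp: K_def d_def)
    then show ?thesis using a(3) by simp
  qed
  have finJ: "finite J" by (simp add: J_def)
  \<comment> \<open>Each index lies in just one block, so the window cannot meet more blocks than it
    has elements.\<close>
  have "{..<N} - J \<subseteq> (\<lambda>b. (b - 1) div m) ` B"
    using K_div by (force simp: J_def)
  then have "card ({..<N} - J) \<le> card B"
    by (rule surj_card_le[rotated]) (simp add: B_def)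
  then have card_J: "card ({..<N} - J) \<le> n0" by (simp add: B_def)
  have Z_ge: "(4 :: ennreal) ^ N * indicator {\<omega>. (self_normalized_sum X n \<omega>)\<^sup>2 > 3 / 4 * real n} \<omega>
      \<le> 2 ^ (4 + 3 * n0) * Z \<omega>" for \<omega>
  proof (cases "(self_normalized_sum X n \<omega>)\<^sup>2 > 3 / 4 * real n")
    case True
    let ?A = "{j. j < N \<and> ?bad j \<omega>}"
    have "card ?A \<le> card ((?A \<inter> J) \<union> ({..<N} - J))"
      by (intro card_mono) (auto simp: finJ)
    also have "\<dots> \<le> card (?A \<inter> J) + card ({..<N} - J)"
      by (rule card_Un_le)
    finally have "card ?A \<le> card (?A \<inter> J) + n0"
      using card_J by linarith
    with many_bad_blocks[OF a True] have le: "2 * N \<le> 4 + 3 * n0 + 3 * card (?A \<inter> J)"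
      by (simp add: N_def)
    have "(4 :: ennreal) ^ N = 2 ^ (2 * N)"
      by (simp add: power_mult)
    also have "\<dots> \<le> 2 ^ (4 + 3 * n0 + 3 * card (?A \<inter> J))"
      by (rule power_increasing[OF le]) simp
    also have "\<dots> = 2 ^ (4 + 3 * n0) * 8 ^ card (?A \<inter> J)"
      by (simp add: power_add power_mult)
    also have "8 ^ card (?A \<inter> J) = Z \<omega>"
      unfolding Z_def using finJ
      by (subst prod.If_cases) (auto intro!: arg_cong[where f = "\<lambda>S. 8 ^ card S"] simp: J_def)
    finally show ?thesis using True by simp
  qed simp
  have Z_int: "(\<integral>\<^sup>+\<omega>. ?G \<omega> * Z \<omega> \<partial>M)
      \<le> ennreal (23 / 16) ^ N * (\<integral>\<^sup>+\<omega>. ennreal (g (t_statistic X n0 \<omega>)) \<partial>M)"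
  proof -
    \<comment> \<open>The blocks have indices below \<open>N\<close>, so \<open>N\<close> is free to
      denote the window.\<close>
    define start l where "start = (\<lambda>j. if j = N then i else j * m)" and "l = (\<lambda>j. if j = N then n0 else m)"
    define f where "f = (\<lambda>j. if j = N then (\<lambda>x. ennreal (g (t_statistic (\<lambda>i x. x i) n0 x)))
      else (\<lambda>x. if \<bar>self_normalized_sum (\<lambda>i x. x i) m x\<bar> > a then 8 else 1))"
    have NJ: "N \<notin> J" by (simp add: J_def)
    have disj: "disjoint_family_on (\<lambda>j. {start j + 1..start j + l j}) (insert N J)"
    proof -
      have "K j \<inter> K j' = {}" if "j \<noteq> j'" for j j'
        using K_div that by blast
      moreover have "{start j + 1..start j + l j} = (if j = N then B else K j)" for j
        by (simp add: start_def l_def B_def K_def)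
      ultimately show ?thesis
        unfolding disjoint_family_on_def by (auto simp: J_def)
    qed
    have meas: "f j \<in> borel_measurable (PiM {1..l j} (\<lambda>_. borel))" for j
    proof -
      have "(\<lambda>x. ennreal (g (t_statistic (\<lambda>i x. x i) n0 x))) \<in> borel_measurable (PiM {1..n0} (\<lambda>_. borel))"
        by measurable
      moreover have "(\<lambda>x. if \<bar>self_normalized_sum (\<lambda>i x. x i) m x\<bar> > a then 8 else 1 :: ennreal)
          \<in> borel_measurable (PiM {1..m} (\<lambda>_. borel))"
        by measurable
      ultimately show ?thesis by (simp add: f_def l_def)
    qed
    have "(\<integral>\<^sup>+\<omega>. ?G \<omega> * Z \<omega> \<partial>M)
        = (\<integral>\<^sup>+\<omega>. (\<Prod>j\<in>insert N J. f j (\<lambda>i\<in>{1..l j}. X (start j + i) \<omega>)) \<partial>M)"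
    proof (intro nn_integral_cong)
      fix \<omega>
      have "Z \<omega> = (\<Prod>j\<in>J. f j (\<lambda>i\<in>{1..l j}. X (start j + i) \<omega>))"
        unfolding Z_def
      proof (rule prod.cong[OF refl])
        fix j assume "j \<in> J"
        with NJ have "j \<noteq> N" by auto
        then show "(if ?bad j \<omega> then 8 else 1) = f j (\<lambda>i\<in>{1..l j}. X (start j + i) \<omega>)"
          using self_normalized_sum_restrict[of m "\<lambda>i. X (j * m + i)" \<omega>]
          by (simp add: f_def l_def start_def)
      qed
      moreover have "?G \<omega> = f N (\<lambda>i\<in>{1..l N}. X (start N + i) \<omega>)"
        using t_statistic_restrict[of n0 "\<lambda>j. X (i + j)" \<omega>]
        by (simp add: f_def l_def start_def)
      ultimately show "?G \<omega> * Z \<omega> = (\<Prod>j\<in>insert N J. f j (\<lambda>i\<in>{1..l j}. X (start j + i) \<omega>))"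
        using finJ NJ by simp
    qed
    also have "\<dots> = (\<Prod>j\<in>insert N J. \<integral>\<^sup>+\<omega>. f j (\<lambda>i\<in>{1..l j}. X i \<omega>) \<partial>M)"
      using finJ disj meas n0 a(3) by (intro nn_integral_prod_shift) (auto simp: l_def)
    also have "\<dots> = (\<integral>\<^sup>+\<omega>. f N (\<lambda>i\<in>{1..l N}. X i \<omega>) \<partial>M) *
        (\<Prod>j\<in>J. \<integral>\<^sup>+\<omega>. f j (\<lambda>i\<in>{1..l j}. X i \<omega>) \<partial>M)"
      using finJ NJ by simp
    also have "(\<integral>\<^sup>+\<omega>. f N (\<lambda>i\<in>{1..l N}. X i \<omega>) \<partial>M) = (\<integral>\<^sup>+\<omega>. ennreal (g (t_statistic X n0 \<omega>)) \<partial>M)"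
      using t_statistic_restrict[of n0 X] by (simp add: f_def l_def)
    also have "(\<integral>\<^sup>+\<omega>. ennreal (g (t_statistic X n0 \<omega>)) \<partial>M) *
        (\<Prod>j\<in>J. \<integral>\<^sup>+\<omega>. f j (\<lambda>i\<in>{1..l j}. X i \<omega>) \<partial>M)
      \<le> (\<integral>\<^sup>+\<omega>. ennreal (g (t_statistic X n0 \<omega>)) \<partial>M) * (\<Prod>j\<in>J. ennreal (23 / 16))"
    proof (intro mult_left_mono prod_mono_ennreal)
      fix j assume "j \<in> J"
      with NJ have "j \<noteq> N" by auto
      let ?E = "{\<omega>\<in>space M. \<bar>self_normalized_sum X m \<omega>\<bar> > a}"
      have "(\<integral>\<^sup>+\<omega>. f j (\<lambda>i\<in>{1..l j}. X i \<omega>) \<partial>M) = (\<integral>\<^sup>+\<omega>. 1 + 7 * indicator ?E \<omega> \<partial>M)"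
        using \<open>j \<noteq> N\<close> self_normalized_sum_restrict[of m X]
        by (intro nn_integral_cong) (auto simp: f_def l_def split: split_indicator)
      also have "\<dots> = 1 + 7 * emeasure M ?E"
        by (subst nn_integral_add) (auto simp: nn_integral_cmult emeasure_space_1)
      also have "\<dots> = ennreal (1 + 7 * prob ?E)"
        by (simp add: emeasure_eq_measure ennreal_plus ennreal_mult)
      also have "\<dots> \<le> ennreal (23 / 16)"
        using bad by (intro ennreal_leI) simp
      finally show "(\<integral>\<^sup>+\<omega>. f j (\<lambda>i\<in>{1..l j}. X i \<omega>) \<partial>M) \<le> ennreal (23 / 16)" .
    qed simp
    \<comment> \<open>Enlarging the number of factors from the size of \<open>J\<close> to
      \<open>N\<close> is harmless, as \<open>23/16\<close> exceeds 1.\<close>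
    also have "\<dots> \<le> (\<integral>\<^sup>+\<omega>. ennreal (g (t_statistic X n0 \<omega>)) \<partial>M) * ennreal (23 / 16) ^ N"
      using card_mono[of "{..<N}" J]
      by (auto simp: J_def intro!: mult_left_mono power_increasing)
    finally show ?thesis
      by (simp add: mult.commute)
  qed
  have "ennreal (4 ^ N) * (\<integral>\<^sup>+\<omega>. ?G \<omega> * indicator {\<omega>. (self_normalized_sum X n \<omega>)\<^sup>2 > 3 / 4 * real n} \<omega> \<partial>M)
      = (\<integral>\<^sup>+\<omega>. ?G \<omega> * (4 ^ N * indicator {\<omega>. (self_normalized_sum X n \<omega>)\<^sup>2 > 3 / 4 * real n} \<omega>) \<partial>M)"
    by (subst nn_integral_cmult[symmetric]) (auto simp: mult_ac ennreal_power[symmetric])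
  also have "\<dots> \<le> (\<integral>\<^sup>+\<omega>. ?G \<omega> * (2 ^ (4 + 3 * n0) * Z \<omega>) \<partial>M)"
    by (intro nn_integral_mono mult_left_mono Z_ge) auto
  also have "\<dots> = 2 ^ (4 + 3 * n0) * (\<integral>\<^sup>+\<omega>. ?G \<omega> * Z \<omega> \<partial>M)"
    by (subst nn_integral_cmult[symmetric]) (auto simp: mult_ac Z_def)
  also have "\<dots> \<le> 2 ^ (4 + 3 * n0) * (ennreal (23 / 16) ^ N * (\<integral>\<^sup>+\<omega>. ennreal (g (t_statistic X n0 \<omega>)) \<partial>M))"
    by (intro mult_left_mono Z_int) auto
  finally have "ennreal (1 / 4 ^ N) * (ennreal (4 ^ N) *
      (\<integral>\<^sup>+\<omega>. ?G \<omega> * indicator {\<omega>. (self_normalized_sum X n \<omega>)\<^sup>2 > 3 / 4 * real n} \<omega> \<partial>M))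
    \<le> ennreal (1 / 4 ^ N) * (2 ^ (4 + 3 * n0) *
      (ennreal (23 / 16) ^ N * (\<integral>\<^sup>+\<omega>. ennreal (g (t_statistic X n0 \<omega>)) \<partial>M)))"
    by (intro mult_left_mono) auto
  moreover have "ennreal (1 / 4 ^ N) * (ennreal (4 ^ N) * x) = x" for x
    by (simp add: mult.assoc[symmetric] ennreal_mult[symmetric])
  moreover have "ennreal (1 / 4 ^ N) * (2 ^ (4 + 3 * n0) * (ennreal (23 / 16) ^ N * x))
      = ennreal (2 ^ (4 + 3 * n0) * (23 / 64) ^ N) * x" for x
  proof -
    have "(2 :: ennreal) ^ (4 + 3 * n0) = ennreal (2 ^ (4 + 3 * n0))"
      by (simp add: ennreal_power[symmetric])
    moreover have "1 / 4 ^ N * (2 ^ (4 + 3 * n0) * (23 / 16) ^ N) = (2 ^ (4 + 3 * n0) * (23 / 64) ^ N :: real)"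
      by (simp add: power_divide power_mult_distrib[symmetric] field_simps)
    ultimately show ?thesis
      by (simp add: mult.assoc[symmetric] ennreal_mult[symmetric] ennreal_power)
  qed
  ultimately show ?thesis by (simp add: N_def)
qed

text \<open>Summing the window estimate over all positions of the window costs only a polynomial
  factor in \<open>n\<close>, which the geometric decay overcomes.\<close>

lemma t_statistic_moment_large_self_normalized_sum:
  assumes a: "a \<ge> 0" "a\<^sup>2 \<le> real m / 4" "m > 0"
    and bad: "prob {\<omega>\<in>space M. \<bar>self_normalized_sum X m \<omega>\<bar> > a} \<le> 1 / 16"
    and n0: "n0 \<ge> 2" and r: "r > 0" and fin: "abs_moment M (t_statistic X n0) r < \<infinity>"
  shows "(\<lambda>n. \<integral>\<^sup>+\<omega>. ennreal (\<bar>t_statistic X n \<omega>\<bar> powr r) *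
      indicator {\<omega>. (self_normalized_sum X n \<omega>)\<^sup>2 > 3 / 4 * real n} \<omega> \<partial>M) \<longlonglongrightarrow> 0"
proof -
  \<comment> \<open>The maximum with 1 matches \<open>abs_t_statistic_le_window\<close> and adds at
    most 1 to the finite moment at \<open>n0\<close>.\<close>
  define g where "g = (\<lambda>x::real. max 1 \<bar>x\<bar> powr r)"
  have g_meas [measurable]: "g \<in> borel_measurable borel" unfolding g_def by measurable
  have "(\<integral>\<^sup>+\<omega>. ennreal (g (t_statistic X n0 \<omega>)) \<partial>M) \<le> (\<integral>\<^sup>+\<omega>. 1 + ennreal (\<bar>t_statistic X n0 \<omega>\<bar> powr r) \<partial>M)"
  proof (intro nn_integral_mono)
    fix \<omega>
    have "ennreal (g (t_statistic X n0 \<omega>)) \<le> ennreal (1 + \<bar>t_statistic X n0 \<omega>\<bar> powr r)"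
      by (intro ennreal_leI) (auto simp: g_def max_def)
    then show "ennreal (g (t_statistic X n0 \<omega>)) \<le> 1 + ennreal (\<bar>t_statistic X n0 \<omega>\<bar> powr r)"
      by (simp add: ennreal_plus)
  qed
  also have "\<dots> = 1 + abs_moment M (t_statistic X n0) r"
    unfolding abs_moment_def by (subst nn_integral_add) (auto simp: emeasure_space_1)
  also have "\<dots> < \<infinity>" using fin by simp
  finally obtain R where R: "R \<ge> 0" "(\<integral>\<^sup>+\<omega>. ennreal (g (t_statistic X n0 \<omega>)) \<partial>M) = ennreal R"
    by (cases "\<integral>\<^sup>+\<omega>. ennreal (g (t_statistic X n0 \<omega>)) \<partial>M") auto
  define c where "c = R * 2 ^ (4 + 3 * n0)"
  let ?D = "\<lambda>n. {\<omega>. (self_normalized_sum X n \<omega>)\<^sup>2 > 3 / 4 * real n}"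
  let ?b = "\<lambda>n. (2 * real n) powr r * (real n + 1) * c * (23 / 64) powr (real n / real m - 1)"
  have bound: "(\<integral>\<^sup>+\<omega>. ennreal (\<bar>t_statistic X n \<omega>\<bar> powr r) * indicator (?D n) \<omega> \<partial>M) \<le> ennreal (?b n)"
    if n: "n \<ge> n0" for n
  proof -
    let ?W = "\<lambda>i \<omega>. ennreal (g (t_statistic (\<lambda>j. X (i + j)) n0 \<omega>))"
    have pointwise: "ennreal (\<bar>t_statistic X n \<omega>\<bar> powr r) \<le> ennreal ((2 * real n) powr r) * (\<Sum>i\<le>n - n0. ?W i \<omega>)" for \<omega>
    proof -
      obtain i where i: "i \<le> n - n0"
        "\<bar>t_statistic X n \<omega>\<bar> \<le> 2 * real n * max 1 \<bar>t_statistic (\<lambda>j. X (i + j)) n0 \<omega>\<bar>"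
        using abs_t_statistic_le_window[OF n0 n, of X \<omega>] by blast
      then have "\<bar>t_statistic X n \<omega>\<bar> powr r \<le> (2 * real n * max 1 \<bar>t_statistic (\<lambda>j. X (i + j)) n0 \<omega>\<bar>) powr r"
        using r by (intro powr_mono2) auto
      also have "\<dots> = (2 * real n) powr r * g (t_statistic (\<lambda>j. X (i + j)) n0 \<omega>)"
        by (simp add: powr_mult g_def)
      finally have "ennreal (\<bar>t_statistic X n \<omega>\<bar> powr r) \<le> ennreal ((2 * real n) powr r) * ?W i \<omega>"
        by (simp add: ennreal_mult[symmetric] g_def)
      also have "\<dots> \<le> ennreal ((2 * real n) powr r) * (\<Sum>i\<le>n - n0. ?W i \<omega>)"
        using i(1) by (intro mult_left_mono member_le_sum) auto
      finally show ?thesis .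
    qed
    have "(\<integral>\<^sup>+\<omega>. ennreal (\<bar>t_statistic X n \<omega>\<bar> powr r) * indicator (?D n) \<omega> \<partial>M)
        \<le> (\<integral>\<^sup>+\<omega>. ennreal ((2 * real n) powr r) * (\<Sum>i\<le>n - n0. ?W i \<omega> * indicator (?D n) \<omega>) \<partial>M)"
      using pointwise
      by (intro nn_integral_mono) (auto simp: sum_distrib_right[symmetric] split: split_indicator)
    also have "\<dots> = ennreal ((2 * real n) powr r) * (\<Sum>i\<le>n - n0. \<integral>\<^sup>+\<omega>. ?W i \<omega> * indicator (?D n) \<omega> \<partial>M)"
      by (subst nn_integral_cmult, measurable, subst nn_integral_sum) auto
    also have "\<dots> \<le> ennreal ((2 * real n) powr r) * (\<Sum>i\<le>n - n0. ennreal (c * (23 / 64) ^ (n div m)))"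
    proof (intro mult_left_mono sum_mono)
      fix i
      have "(\<integral>\<^sup>+\<omega>. ?W i \<omega> * indicator (?D n) \<omega> \<partial>M) \<le> ennreal (2 ^ (4 + 3 * n0) * (23 / 64) ^ (n div m)) * ennreal R"
        using window_moment_large_self_normalized_sum[OF a bad, of n0 g i n] n0 R(2) by simp
      also have "\<dots> = ennreal (c * (23 / 64) ^ (n div m))"
        using R(1) by (simp add: c_def ennreal_mult[symmetric] mult_ac)
      finally show "(\<integral>\<^sup>+\<omega>. ?W i \<omega> * indicator (?D n) \<omega> \<partial>M) \<le> ennreal (c * (23 / 64) ^ (n div m))" .
    qed auto
    also have "\<dots> = ennreal ((2 * real n) powr r * (real (Suc (n - n0)) * (c * (23 / 64) ^ (n div m))))"
      using R(1) by (simp add: c_def ennreal_mult' ennreal_of_nat_eq_real_of_nat)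
    \<comment> \<open>As the base is below 1, \<open>n div m\<close> may be replaced by the smaller
      exponent \<open>n / m - 1\<close>, which has no rounding.\<close>
    also have "\<dots> \<le> ennreal ((2 * real n) powr r * ((real n + 1) * (c * (23 / 64) powr (real n / real m - 1))))"
    proof (intro ennreal_leI mult_left_mono mult_mono)
      have "real n / real m < real (n div m) + 1"
        using real_of_int_floor_add_one_gt[of "real n / real m"] by (simp add: floor_divide_of_nat_eq)
      then have "(23 / 64 :: real) powr real (n div m) \<le> (23 / 64) powr (real n / real m - 1)"
        by (intro powr_mono') auto
      then show "(23 / 64 :: real) ^ (n div m) \<le> (23 / 64) powr (real n / real m - 1)"
        by (simp add: powr_realpow)
    qed (use R(1) in \<open>auto simp: c_def\<close>)
    finally show ?thesis by (simp add: mult_ac)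
  qed
  define \<kappa> where "\<kappa> = - ln (23 / 64 :: real) / real m"
  have "\<kappa> > 0" using a(3) by (auto simp: \<kappa>_def intro!: divide_neg_pos)
  then have "(\<lambda>n. (2 * real n) powr r * (real n + 1) * exp (- \<kappa> * real n)) \<longlonglongrightarrow> 0"
    by real_asymp
  then have "(\<lambda>n. (64 / 23 * c) * ((2 * real n) powr r * (real n + 1) * exp (- \<kappa> * real n))) \<longlonglongrightarrow> 0"
    by (rule tendsto_mult_right_zero)
  also have "(\<lambda>n. (64 / 23 * c) * ((2 * real n) powr r * (real n + 1) * exp (- \<kappa> * real n))) = ?b"
  proof (rule ext)
    fix n :: nat
    have "(23 / 64 :: real) powr (real n / real m - 1) = 64 / 23 * (23 / 64) powr (real n / real m)"
      by (subst powr_diff) simp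
    also have "(23 / 64 :: real) powr (real n / real m) = exp (- \<kappa> * real n)"
      by (simp add: powr_def \<kappa>_def)
    finally show "(64 / 23 * c) * ((2 * real n) powr r * (real n + 1) * exp (- \<kappa> * real n)) = ?b n"
      by simp
  qed
  finally have "?b \<longlonglongrightarrow> 0" .
  then have "(\<lambda>n. ennreal (?b n)) \<longlonglongrightarrow> 0"
    using tendsto_ennrealI by fastforce
  then show ?thesis
  proof (rule tendsto_sandwich[OF _ _ tendsto_const, rotated 2])
    show "\<forall>\<^sub>F n in sequentially. (\<integral>\<^sup>+\<omega>. ennreal (\<bar>t_statistic X n \<omega>\<bar> powr r) * indicator (?D n) \<omega> \<partial>M) \<le> ennreal (?b n)"
      using bound eventually_ge_at_top by (rule eventually_mono[rotated]) auto
  qed auto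
qed

end

section \<open>Convergence of the moments\<close>

text \<open>Bounded continuous test functions, transferred from the laws to random variables on
  possibly different spaces.\<close>

lemma weak_conv_m_distr_expectation:
  fixes Y :: "nat \<Rightarrow> 'a \<Rightarrow> real" and T :: "'b \<Rightarrow> real" and f :: "real \<Rightarrow> real"
  assumes "prob_space M" "prob_space N"
    and Y: "\<And>n. Y n \<in> borel_measurable M" and T: "T \<in> borel_measurable N"
    and weak: "weak_conv_m (\<lambda>n. distr M borel (Y n)) (distr N borel T)"
    and f: "\<And>x. isCont f x" "\<And>x. \<bar>f x\<bar> \<le> B"
  shows "(\<lambda>n. \<integral>\<omega>. f (Y n \<omega>) \<partial>M) \<longlonglongrightarrow> (\<integral>\<omega>. f (T \<omega>) \<partial>N)"
proof -
  interpret M: prob_space M by fact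
  interpret N: prob_space N by fact
  have [measurable]: "f \<in> borel_measurable borel"
    using f(1) by (intro borel_measurable_continuous_onI) (simp add: continuous_at_imp_continuous_on)
  have "real_distribution (distr M borel (Y n))" for n
    using Y by (auto simp: real_distribution_def real_distribution_axioms_def intro: M.prob_space_distr)
  moreover have "real_distribution (distr N borel T)"
    using T by (auto simp: real_distribution_def real_distribution_axioms_def intro: N.prob_space_distr)
  ultimately have "(\<lambda>n. integral\<^sup>L (distr M borel (Y n)) f) \<longlonglongrightarrow> integral\<^sup>L (distr N borel T) f"
    using weak f by (intro weak_conv_imp_integral_bdd_continuous_conv[where B = B]) auto
  then show ?thesis
    using Y T by (simp add: integral_distr)
qed

lemma ennreal_diff_le:
  assumes "ennreal x \<le> u + ennreal y" "y \<ge> 0"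
  shows "ennreal (x - y) \<le> u"
proof (cases u)
  case (real v)
  then have "ennreal x \<le> ennreal (v + y)" using assms by (simp add: ennreal_plus)
  then have "x \<le> v + y" using real assms(2) by (subst (asm) ennreal_le_iff) auto
  then show ?thesis using real by (auto intro: ennreal_leI)
qed simp

context iid_sequence
begin

text \<open>Weak convergence controls all large \<open>n\<close> through a continuous test function;
  the finitely many others satisfy the deterministic bound
  \<open>|Q\<^sub>n| \<le> sqrt n\<close>.\<close>

lemma self_normalized_sum_tight:
  fixes T :: "'b \<Rightarrow> real"
  assumes "prob_space N" and T [measurable]: "T \<in> borel_measurable N"
    and weak: "weak_conv_m (\<lambda>n. distr M borel (self_normalized_sum X n)) (distr N borel T)"
  obtains a where "a \<ge> 0" "\<And>n. prob {\<omega>\<in>space M. \<bar>self_normalized_sum X n \<omega>\<bar> > a} \<le> 1 / 16"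
proof -
  interpret N: prob_space N by fact
  \<comment> \<open>A continuous ramp, zero up to \<open>|x| = k\<close> and one from
    \<open>|x| = k + 1\<close> on.\<close>
  define f where "f = (\<lambda>(k::nat) (x::real). min 1 (max 0 (\<bar>x\<bar> - real k)))"
  have f_meas [measurable]: "f k \<in> borel_measurable borel" for k by (simp add: f_def)
  have "(\<lambda>k. \<integral>\<omega>. f k (T \<omega>) \<partial>N) \<longlonglongrightarrow> (\<integral>\<omega>. 0 \<partial>N)"
  proof (rule integral_dominated_convergence[where w = "\<lambda>_. 1"])
    show "AE \<omega> in N. (\<lambda>k. f k (T \<omega>)) \<longlonglongrightarrow> 0"
    proof (intro AE_I2 tendsto_eventually)
      fix \<omega>
      obtain k0 where "\<bar>T \<omega>\<bar> \<le> real k0" using real_arch_simple by blast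
      then show "\<forall>\<^sub>F k in sequentially. f k (T \<omega>) = 0"
        by (intro eventually_sequentiallyI[of k0]) (auto simp: f_def)
    qed
  qed (auto simp: f_def)
  then have "\<forall>\<^sub>F k in sequentially. (\<integral>\<omega>. f k (T \<omega>) \<partial>N) < 1 / 16"
    by (rule order_tendstoD) simp
  then obtain k where k: "(\<integral>\<omega>. f k (T \<omega>) \<partial>N) < 1 / 16"
    by (auto simp: eventually_sequentially)
  have "(\<lambda>n. expectation (\<lambda>\<omega>. f k (self_normalized_sum X n \<omega>))) \<longlonglongrightarrow> (\<integral>\<omega>. f k (T \<omega>) \<partial>N)"
    using weak T \<open>prob_space N\<close> prob_space_axioms
    by (intro weak_conv_m_distr_expectation[where B = 1])
      (auto simp: f_def intro!: continuous_intros)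
  then have "\<forall>\<^sub>F n in sequentially. expectation (\<lambda>\<omega>. f k (self_normalized_sum X n \<omega>)) < 1 / 16"
    using k by (rule order_tendstoD)
  then obtain n1 where n1: "expectation (\<lambda>\<omega>. f k (self_normalized_sum X n \<omega>)) < 1 / 16" if "n \<ge> n1" for n
    by (auto simp: eventually_sequentially)
  \<comment> \<open>The first entry serves \<open>n \<ge> n1\<close>; the second makes the event
    empty for smaller \<open>n\<close>.\<close>
  define a where "a = max (real k + 1) (sqrt (real n1))"
  show ?thesis
  proof
    show "a \<ge> 0" by (simp add: a_def)
    fix n
    show "prob {\<omega>\<in>space M. \<bar>self_normalized_sum X n \<omega>\<bar> > a} \<le> 1 / 16"
    proof (cases "n \<ge> n1")
      case True
      have "prob {\<omega>\<in>space M. \<bar>self_normalized_sum X n \<omega>\<bar> > a}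
          = expectation (indicator {\<omega>\<in>space M. \<bar>self_normalized_sum X n \<omega>\<bar> > a})"
        by simp
      also have "\<dots> \<le> expectation (\<lambda>\<omega>. f k (self_normalized_sum X n \<omega>))"
      proof (intro integral_mono)
        show "integrable M (\<lambda>\<omega>. f k (self_normalized_sum X n \<omega>))"
          by (rule integrable_const_bound[where B = 1]) (auto simp: f_def)
      qed (auto simp: f_def a_def emeasure_eq_measure split: split_indicator)
      also have "\<dots> < 1 / 16" using n1[OF True] .
      finally show ?thesis by simp
    next
      case False
      have "\<not> \<bar>self_normalized_sum X n \<omega>\<bar> > a" for \<omega>
      proof -
        have "\<bar>self_normalized_sum X n \<omega>\<bar> = sqrt ((self_normalized_sum X n \<omega>)\<^sup>2)" by simp
        also have "\<dots> \<le> sqrt (real n1)"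
          using self_normalized_sum_sq_le[of X n \<omega>] False by (intro real_sqrt_le_mono) auto
        finally show ?thesis by (simp add: a_def)
      qed
      then show ?thesis by simp
    qed
  qed
qed

text \<open>Truncation at a level \<open>A\<close>: truncated moments converge by weak convergence,
  and the tail beyond \<open>A\<close> costs a multiple of \<open>C / A\<close> since
  \<open>r + 1 \<le> 2 q\<close>. First \<open>n\<close> tends to infinity, then
  \<open>A\<close>.\<close>

lemma t_statistic_moment_tendsto:
  fixes T :: "'b \<Rightarrow> real" and q :: nat
  assumes "prob_space N" and T [measurable]: "T \<in> borel_measurable N"
    and weak: "weak_conv_m (\<lambda>n. distr M borel (self_normalized_sum X n)) (distr N borel T)"
    and r: "r > 0" "r + 1 \<le> real (2 * q)"
    and C: "C \<ge> 0" "\<And>n. n \<ge> 2 \<Longrightarrow> (\<integral>\<^sup>+\<omega>. ennreal (self_normalized_sum X n \<omega> ^ (2 * q)) \<partial>M) \<le> ennreal C"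
    and large: "(\<lambda>n. \<integral>\<^sup>+\<omega>. ennreal (\<bar>t_statistic X n \<omega>\<bar> powr r) *
      indicator {\<omega>. (self_normalized_sum X n \<omega>)\<^sup>2 > 3 / 4 * real n} \<omega> \<partial>M) \<longlonglongrightarrow> 0"
  shows "abs_moment N T r < \<infinity>"
    and "(\<lambda>n. abs_moment M (t_statistic X n) r) \<longlonglongrightarrow> abs_moment N T r"
proof -
  interpret N: prob_space N by fact
  let ?Q = "self_normalized_sum X" and ?t = "t_statistic X"
  let ?D = "\<lambda>n. {\<omega>. (?Q n \<omega>)\<^sup>2 > 3 / 4 * real n}"
  define e where "e = (\<lambda>n. \<integral>\<^sup>+\<omega>. ennreal (\<bar>?t n \<omega>\<bar> powr r) * indicator (?D n) \<omega> \<partial>M)"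
  have e: "e \<longlonglongrightarrow> 0" using large by (simp add: e_def)
  define f where "f = (\<lambda>(A::nat) (x::real). min \<bar>x\<bar> (real A) powr r)"
  have f0: "0 \<le> f A x" for A x by (simp add: f_def)
  have f_bdd: "\<bar>f A x\<bar> \<le> real A powr r" for A x
    using r by (auto simp: f_def intro!: powr_mono2)
  have f_cont: "isCont (f A) x" for A x
    using r unfolding f_def by (intro continuous_intros) auto
  have f_meas [measurable]: "f A \<in> borel_measurable borel" for A by (simp add: f_def)
  have f_le: "f A x \<le> \<bar>x\<bar> powr r" for A x
    using r by (auto simp: f_def intro!: powr_mono2)
  define \<tau> where "\<tau> = (\<lambda>A. \<integral>\<omega>. f A (T \<omega>) \<partial>N)"
  define \<mu> where "\<mu> = (\<lambda>A n. expectation (\<lambda>\<omega>. f A (?Q n \<omega>)))"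
  have \<mu>_lim: "\<mu> A \<longlonglongrightarrow> \<tau> A" for A
    unfolding \<mu>_def \<tau>_def using weak T \<open>prob_space N\<close> prob_space_axioms f_cont f_bdd
    by (intro weak_conv_m_distr_expectation) auto
  have int_Q: "integrable M (\<lambda>\<omega>. f A (?Q n \<omega>))" for A n
    using f_bdd by (intro integrable_const_bound[where B = "real A powr r"]) auto
  have int_T: "integrable N (\<lambda>\<omega>. f A (T \<omega>))" for A
    using f_bdd by (intro N.integrable_const_bound[where B = "real A powr r"]) auto
  have nn_Q: "(\<integral>\<^sup>+\<omega>. ennreal (f A (?Q n \<omega>)) \<partial>M) = ennreal (\<mu> A n)" for A n
    unfolding \<mu>_def using f0 by (intro nn_integral_eq_integral int_Q) auto
  have nn_T: "(\<integral>\<^sup>+\<omega>. ennreal (f A (T \<omega>)) \<partial>N) = ennreal (\<tau> A)" for A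
    unfolding \<tau>_def using f0 by (intro nn_integral_eq_integral int_T) auto
  have powr_le_power: "\<bar>x\<bar> powr r \<le> 1 + x ^ (2 * q)" for x :: real
  proof (cases "\<bar>x\<bar> \<le> 1")
    case True
    then have "\<bar>x\<bar> powr r \<le> 1" using r by (intro powr_le1) auto
    moreover have "0 \<le> x ^ (2 * q)" by (simp add: zero_le_even_power)
    ultimately show ?thesis by linarith
  next
    case False
    then have "\<bar>x\<bar> powr r \<le> \<bar>x\<bar> powr real (2 * q)" using r by (intro powr_mono) auto
    also have "\<dots> = x ^ (2 * q)" using False by (subst powr_realpow) (auto simp: power_even_abs)
    finally show ?thesis by simp
  qed
  have powr_tail: "\<bar>x\<bar> powr r \<le> x ^ (2 * q) / real A" if "A \<ge> 1" "\<bar>x\<bar> > real A" for x :: real and A :: nat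
  proof -
    have "real A * \<bar>x\<bar> powr r \<le> \<bar>x\<bar> powr 1 * \<bar>x\<bar> powr r"
      using that by (intro mult_right_mono) auto
    also have "\<dots> = \<bar>x\<bar> powr (r + 1)" by (simp add: powr_add mult.commute)
    also have "\<dots> \<le> \<bar>x\<bar> powr real (2 * q)" using that r by (intro powr_mono) auto
    also have "\<dots> = x ^ (2 * q)" using that by (subst powr_realpow) (auto simp: power_even_abs)
    finally show ?thesis using that by (simp add: field_simps)
  qed
  \<comment> \<open>The bound on the moments of \<open>Q\<^sub>n\<close> passes to the truncated
    moments of the limit uniformly in \<open>A\<close>; Fatou's lemma then gives a finite moment of
    \<open>T\<close>.\<close>
  have \<tau>_le: "\<tau> A \<le> 1 + C" for A
  proof (rule tendsto_upperbound[OF \<mu>_lim])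
    show "\<forall>\<^sub>F n in sequentially. \<mu> A n \<le> 1 + C"
    proof (rule eventually_sequentiallyI[of 2])
      fix n :: nat assume n: "n \<ge> 2"
      have "ennreal (\<mu> A n) \<le> (\<integral>\<^sup>+\<omega>. 1 + ennreal (?Q n \<omega> ^ (2 * q)) \<partial>M)"
        unfolding nn_Q[symmetric]
      proof (intro nn_integral_mono)
        fix \<omega>
        have "ennreal (f A (?Q n \<omega>)) \<le> ennreal (1 + ?Q n \<omega> ^ (2 * q))"
          using f_le[of A "?Q n \<omega>"] powr_le_power[of "?Q n \<omega>"] by (intro ennreal_leI) linarith
        then show "ennreal (f A (?Q n \<omega>)) \<le> 1 + ennreal (?Q n \<omega> ^ (2 * q))"
          by (simp add: ennreal_plus zero_le_even_power)
      qed
      also have "\<dots> = 1 + (\<integral>\<^sup>+\<omega>. ennreal (?Q n \<omega> ^ (2 * q)) \<partial>M)"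
        by (subst nn_integral_add) (auto simp: emeasure_space_1)
      also have "\<dots> \<le> 1 + ennreal C" using C(2)[OF n] by (intro add_left_mono)
      also have "\<dots> = ennreal (1 + C)" using C(1) by (simp add: ennreal_plus)
      finally show "\<mu> A n \<le> 1 + C" using C(1) by (subst (asm) ennreal_le_iff) auto
    qed
  qed simp
  have f_lim: "(\<lambda>A. f A x) \<longlonglongrightarrow> \<bar>x\<bar> powr r" for x
  proof (rule tendsto_eventually)
    obtain A0 where "\<bar>x\<bar> \<le> real A0" using real_arch_simple by blast
    then show "\<forall>\<^sub>F A in sequentially. f A x = \<bar>x\<bar> powr r"
      by (intro eventually_sequentiallyI[of A0]) (auto simp: f_def min_def)
  qed
  have "abs_moment N T r = (\<integral>\<^sup>+\<omega>. liminf (\<lambda>A. ennreal (f A (T \<omega>))) \<partial>N)"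
    unfolding abs_moment_def
    by (intro nn_integral_cong lim_imp_Liminf[symmetric] tendsto_ennrealI f_lim) simp
  also have "\<dots> \<le> liminf (\<lambda>A. ennreal (\<tau> A))"
    unfolding nn_T[symmetric] by (intro nn_integral_liminf) measurable
  also have "\<dots> \<le> liminf (\<lambda>A::nat. ennreal (1 + C))"
    using \<tau>_le by (intro Liminf_mono always_eventually allI ennreal_leI)
  also have "\<dots> < \<infinity>" by (simp add: Liminf_const)
  finally show fin: "abs_moment N T r < \<infinity>" .
  have int_T': "integrable N (\<lambda>\<omega>. \<bar>T \<omega>\<bar> powr r)"
    using fin by (intro integrableI_nonneg) (auto simp: abs_moment_def)
  define l where "l = (\<integral>\<omega>. \<bar>T \<omega>\<bar> powr r \<partial>N)"
  have l: "abs_moment N T r = ennreal l"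
    unfolding abs_moment_def l_def by (intro nn_integral_eq_integral int_T') auto
  have \<tau>_lim: "\<tau> \<longlonglongrightarrow> l"
    unfolding \<tau>_def l_def using f_lim f_le f0
    by (intro integral_dominated_convergence[where w = "\<lambda>\<omega>. \<bar>T \<omega>\<bar> powr r"] int_T') auto
  define u where "u = (\<lambda>n. abs_moment M (?t n) r)"
  \<comment> \<open>The ratio of the two statistics, to the power \<open>r\<close>, lies between
    \<open>\<kappa> n\<close> and \<open>\<theta> A n\<close> where
    \<open>0 < |Q\<^sub>n| \<le> A\<close> and \<open>n\<close> is large; both tend to 1.\<close>
  define \<theta> where "\<theta> = (\<lambda>A n. sqrt ((real n - 1) / (real n - (real A)\<^sup>2)) powr r)"
  have \<theta>_lim: "\<theta> A \<longlonglongrightarrow> 1" for A :: nat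
  proof -
    have "(\<lambda>n. (real n - 1) / (real n - (real A)\<^sup>2)) \<longlonglongrightarrow> 1" by real_asymp
    then have "(\<lambda>n. sqrt ((real n - 1) / (real n - (real A)\<^sup>2)) powr r) \<longlonglongrightarrow> sqrt 1 powr r"
      by (intro tendsto_powr tendsto_real_sqrt tendsto_const) auto
    then show ?thesis by (simp add: \<theta>_def)
  qed
  define \<kappa> where "\<kappa> = (\<lambda>n. sqrt ((real n - 1) / real n) powr r)"
  have \<kappa>_lim: "\<kappa> \<longlonglongrightarrow> 1"
  proof -
    have "(\<lambda>n. (real n - 1) / real n) \<longlonglongrightarrow> 1" by real_asymp
    then have "(\<lambda>n. sqrt ((real n - 1) / real n) powr r) \<longlonglongrightarrow> sqrt 1 powr r"
      by (intro tendsto_powr tendsto_real_sqrt tendsto_const) auto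
    then show ?thesis by (simp add: \<kappa>_def)
  qed
  have tail_int: "(\<integral>\<^sup>+\<omega>. ennreal (?Q n \<omega> ^ (2 * q) / real A) \<partial>M) \<le> ennreal (C / real A)"
    if "n \<ge> 2" "A \<ge> 1" for n A :: nat
  proof -
    have "(\<integral>\<^sup>+\<omega>. ennreal (?Q n \<omega> ^ (2 * q) / real A) \<partial>M)
        = (\<integral>\<^sup>+\<omega>. ennreal (1 / real A) * ennreal (?Q n \<omega> ^ (2 * q)) \<partial>M)"
      by (intro nn_integral_cong) (simp add: ennreal_mult'[symmetric])
    also have "\<dots> = ennreal (1 / real A) * (\<integral>\<^sup>+\<omega>. ennreal (?Q n \<omega> ^ (2 * q)) \<partial>M)"
      by (rule nn_integral_cmult) simp
    also have "\<dots> \<le> ennreal (1 / real A) * ennreal C"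
      by (intro mult_left_mono C that) simp
    also have "\<dots> = ennreal (C / real A)" using C(1) by (simp add: ennreal_mult'[symmetric])
    finally show ?thesis .
  qed
  have upper: "u n \<le> ennreal (\<theta> A n * \<mu> A n + 2 powr r * (C / real A)) + e n"
    if n: "n \<ge> 2" "real n > (real A)\<^sup>2" and A: "A \<ge> 1" for n A :: nat
  proof -
    have ptw: "ennreal (\<bar>?t n \<omega>\<bar> powr r) \<le> ennreal (\<theta> A n) * ennreal (f A (?Q n \<omega>)) +
        ennreal (2 powr r) * ennreal (?Q n \<omega> ^ (2 * q) / real A) + ennreal (\<bar>?t n \<omega>\<bar> powr r) * indicator (?D n) \<omega>"
      (is "_ \<le> ?a + ?b + ?c") for \<omega>
    proof -
      \<comment> \<open>In the middle region the t-statistic is at most twice the self-normalized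
        sum and the tail estimate applies; the last region is the event whose contribution
        vanishes.\<close>
      consider "\<bar>?Q n \<omega>\<bar> \<le> real A" | "\<bar>?Q n \<omega>\<bar> > real A" "\<omega> \<notin> ?D n" | "\<omega> \<in> ?D n" by fastforce
      then show ?thesis
      proof cases
        case 1
        then have "(?Q n \<omega>)\<^sup>2 \<le> (real A)\<^sup>2" using abs_le_square_iff[of "?Q n \<omega>" "real A"] by simp
        then have "\<bar>?t n \<omega>\<bar> \<le> sqrt ((real n - 1) / (real n - (real A)\<^sup>2)) * \<bar>?Q n \<omega>\<bar>"
          using n by (intro abs_t_statistic_le)
        then have "\<bar>?t n \<omega>\<bar> powr r \<le> (sqrt ((real n - 1) / (real n - (real A)\<^sup>2)) * \<bar>?Q n \<omega>\<bar>) powr r"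
          using r by (intro powr_mono2) auto
        also have "\<dots> = \<theta> A n * f A (?Q n \<omega>)"
          using 1 n by (subst powr_mult) (auto simp: \<theta>_def f_def min_def)
        finally have "ennreal (\<bar>?t n \<omega>\<bar> powr r) \<le> ?a"
          by (simp add: ennreal_mult''[symmetric] f0 ennreal_leI)
        then show ?thesis by (metis add_increasing2 zero_le)
      next
        case 2
        then have "\<bar>?t n \<omega>\<bar> \<le> 2 * \<bar>?Q n \<omega>\<bar>" using n by (intro abs_t_statistic_le_2) auto
        then have "\<bar>?t n \<omega>\<bar> powr r \<le> (2 * \<bar>?Q n \<omega>\<bar>) powr r"
          using r by (intro powr_mono2) auto
        also have "\<dots> = 2 powr r * \<bar>?Q n \<omega>\<bar> powr r" by (subst powr_mult) auto
        also have "\<dots> \<le> 2 powr r * (?Q n \<omega> ^ (2 * q) / real A)"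
          using A 2 by (intro mult_left_mono powr_tail) auto
        finally have "ennreal (\<bar>?t n \<omega>\<bar> powr r) \<le> ?b"
          by (simp add: ennreal_mult'[symmetric] ennreal_leI)
        then show ?thesis by (metis add_increasing add_increasing2 zero_le)
      next
        case 3
        then have "ennreal (\<bar>?t n \<omega>\<bar> powr r) \<le> ?c" by simp
        then show ?thesis by (metis add_increasing zero_le)
      qed
    qed
    have "u n \<le> (\<integral>\<^sup>+\<omega>. ennreal (\<theta> A n) * ennreal (f A (?Q n \<omega>)) +
        ennreal (2 powr r) * ennreal (?Q n \<omega> ^ (2 * q) / real A) + ennreal (\<bar>?t n \<omega>\<bar> powr r) * indicator (?D n) \<omega> \<partial>M)"
      unfolding u_def abs_moment_def by (intro nn_integral_mono ptw)
    also have "\<dots> = ennreal (\<theta> A n) * ennreal (\<mu> A n) +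
        ennreal (2 powr r) * (\<integral>\<^sup>+\<omega>. ennreal (?Q n \<omega> ^ (2 * q) / real A) \<partial>M) + e n"
      by (simp add: nn_integral_add nn_integral_cmult nn_Q e_def)
    also have "\<dots> \<le> ennreal (\<theta> A n) * ennreal (\<mu> A n) + ennreal (2 powr r) * ennreal (C / real A) + e n"
      using tail_int[OF n(1) A] by (intro add_mono mult_left_mono) auto
    also have "\<dots> = ennreal (\<theta> A n * \<mu> A n + 2 powr r * (C / real A)) + e n"
    proof -
      have nonneg: "0 \<le> \<theta> A n" "0 \<le> \<mu> A n" "0 \<le> 2 powr r" "0 \<le> C / real A"
        unfolding \<mu>_def \<theta>_def using f0 C(1) by simp_all
      then have "0 \<le> \<theta> A n * \<mu> A n" "0 \<le> 2 powr r * (C / real A)" 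
        by (simp_all only: mult_nonneg_nonneg)
      with nonneg show ?thesis by (simp only: ennreal_plus ennreal_mult)
    qed
    finally show ?thesis .
  qed
  have lower: "ennreal (\<kappa> n * \<mu> A n - C / real A) \<le> u n"
    if n: "n \<ge> 2" "real n > (real A)\<^sup>2" and A: "A \<ge> 1" for n A :: nat
  proof (rule ennreal_diff_le)
    have ptw: "ennreal (\<kappa> n) * ennreal (f A (?Q n \<omega>)) \<le>
        ennreal (\<bar>?t n \<omega>\<bar> powr r) + ennreal (?Q n \<omega> ^ (2 * q) / real A)" for \<omega>
    proof -
      have "\<kappa> n * f A (?Q n \<omega>) \<le> \<bar>?t n \<omega>\<bar> powr r + ?Q n \<omega> ^ (2 * q) / real A"
      proof (cases "\<bar>?Q n \<omega>\<bar> \<le> real A")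
        case True
        then have "(?Q n \<omega>)\<^sup>2 \<le> (real A)\<^sup>2" using abs_le_square_iff[of "?Q n \<omega>" "real A"] by simp
        then have "sqrt ((real n - 1) / real n) * \<bar>?Q n \<omega>\<bar> \<le> \<bar>?t n \<omega>\<bar>"
          using n by (intro abs_t_statistic_ge) linarith+
        then have "(sqrt ((real n - 1) / real n) * \<bar>?Q n \<omega>\<bar>) powr r \<le> \<bar>?t n \<omega>\<bar> powr r"
          using r n by (intro powr_mono2) auto
        moreover have "\<kappa> n * f A (?Q n \<omega>) = (sqrt ((real n - 1) / real n) * \<bar>?Q n \<omega>\<bar>) powr r"
          using True n by (subst powr_mult) (auto simp: \<kappa>_def f_def min_def)
        moreover have "0 \<le> ?Q n \<omega> ^ (2 * q) / real A" by (simp add: zero_le_even_power)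
        ultimately show ?thesis by linarith
      next
        \<comment> \<open>Beyond the level, the truncated value itself is covered by the tail
          term.\<close>
        case False
        have "sqrt ((real n - 1) / real n) \<le> sqrt 1"
          using n by (intro real_sqrt_le_mono) auto
        then have "\<kappa> n \<le> 1" unfolding \<kappa>_def using r n by (intro powr_le1) auto
        then have "\<kappa> n * f A (?Q n \<omega>) \<le> 1 * \<bar>?Q n \<omega>\<bar> powr r"
          using f_le f0 by (intro mult_mono) auto
        also have "\<dots> \<le> ?Q n \<omega> ^ (2 * q) / real A"
          using powr_tail[OF A] False by simp
        also have "\<dots> \<le> \<bar>?t n \<omega>\<bar> powr r + ?Q n \<omega> ^ (2 * q) / real A" by simp
        finally show ?thesis .
      qed
      then have "ennreal (\<kappa> n * f A (?Q n \<omega>)) \<le> ennreal (\<bar>?t n \<omega>\<bar> powr r + ?Q n \<omega> ^ (2 * q) / real A)"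
        by (rule ennreal_leI)
      then show ?thesis
        by (simp add: ennreal_mult''[symmetric] f0 ennreal_plus zero_le_even_power)
    qed
    have "ennreal (\<kappa> n * \<mu> A n) = (\<integral>\<^sup>+\<omega>. ennreal (\<kappa> n) * ennreal (f A (?Q n \<omega>)) \<partial>M)"
      by (simp add: nn_integral_cmult nn_Q ennreal_mult' \<kappa>_def)
    also have "\<dots> \<le> (\<integral>\<^sup>+\<omega>. ennreal (\<bar>?t n \<omega>\<bar> powr r) + ennreal (?Q n \<omega> ^ (2 * q) / real A) \<partial>M)"
      by (intro nn_integral_mono ptw)
    also have "\<dots> = u n + (\<integral>\<^sup>+\<omega>. ennreal (?Q n \<omega> ^ (2 * q) / real A) \<partial>M)"
      by (simp add: nn_integral_add u_def abs_moment_def)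
    also have "\<dots> \<le> u n + ennreal (C / real A)"
      using tail_int[OF n(1) A] by (intro add_left_mono)
    finally show "ennreal (\<kappa> n * \<mu> A n) \<le> u n + ennreal (C / real A)" .
  qed (use C in simp)
  have large_n: "\<forall>\<^sub>F n in sequentially. n \<ge> 2 \<and> real n > (real A)\<^sup>2" for A :: nat
    using eventually_ge_at_top[of 2] eventually_gt_at_top[of "A\<^sup>2"]
    by eventually_elim (simp add: of_nat_power[symmetric] del: of_nat_power)
  have limsup: "limsup u \<le> ennreal l"
  proof (rule tendsto_lowerbound)
    have "(\<lambda>A. \<tau> A + 2 powr r * (C / real A)) \<longlonglongrightarrow> l + 2 powr r * 0"
      by (intro tendsto_intros \<tau>_lim)
    then show "(\<lambda>A. ennreal (\<tau> A + 2 powr r * (C / real A))) \<longlonglongrightarrow> ennreal l"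
      by (intro tendsto_ennrealI) simp
    show "\<forall>\<^sub>F A in sequentially. limsup u \<le> ennreal (\<tau> A + 2 powr r * (C / real A))"
    proof (rule eventually_sequentiallyI[of 1])
      fix A :: nat assume A: "A \<ge> 1"
      have "limsup u \<le> limsup (\<lambda>n. ennreal (\<theta> A n * \<mu> A n + 2 powr r * (C / real A)) + e n)"
        by (intro Limsup_mono eventually_mono[OF large_n[of A]] upper A) auto
      also have "(\<lambda>n. ennreal (\<theta> A n * \<mu> A n + 2 powr r * (C / real A)) + e n)
          \<longlonglongrightarrow> ennreal (1 * \<tau> A + 2 powr r * (C / real A)) + 0"
        by (intro tendsto_add e tendsto_ennrealI tendsto_mult \<theta>_lim \<mu>_lim tendsto_const)
      then have "limsup (\<lambda>n. ennreal (\<theta> A n * \<mu> A n + 2 powr r * (C / real A)) + e n)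
          = ennreal (\<tau> A + 2 powr r * (C / real A))"
        by (intro lim_imp_Limsup) auto
      finally show "limsup u \<le> ennreal (\<tau> A + 2 powr r * (C / real A))" .
    qed
  qed simp
  \<comment> \<open>As for the upper limit, the bound holds for each fixed \<open>A\<close> once
    \<open>n\<close> is large, and then \<open>A\<close> grows.\<close>
  have liminf: "ennreal l \<le> liminf u"
  proof (rule tendsto_upperbound)
    have "(\<lambda>A. \<tau> A - C / real A) \<longlonglongrightarrow> l - 0"
      by (intro tendsto_intros \<tau>_lim)
    then show "(\<lambda>A. ennreal (\<tau> A - C / real A)) \<longlonglongrightarrow> ennreal l"
      by (intro tendsto_ennrealI) simp
    show "\<forall>\<^sub>F A in sequentially. ennreal (\<tau> A - C / real A) \<le> liminf u"
    proof (rule eventually_sequentiallyI[of 1])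
      fix A :: nat assume A: "A \<ge> 1"
      have "(\<lambda>n. ennreal (\<kappa> n * \<mu> A n - C / real A)) \<longlonglongrightarrow> ennreal (1 * \<tau> A - C / real A)"
        by (intro tendsto_ennrealI tendsto_diff tendsto_mult \<kappa>_lim \<mu>_lim tendsto_const)
      then have "ennreal (\<tau> A - C / real A) = liminf (\<lambda>n. ennreal (\<kappa> n * \<mu> A n - C / real A))"
        by (intro lim_imp_Liminf[symmetric]) auto
      also have "\<dots> \<le> liminf u"
        by (intro Liminf_mono eventually_mono[OF large_n[of A]] lower A) auto
      finally show "ennreal (\<tau> A - C / real A) \<le> liminf u" .
    qed
  qed simp
  have "liminf u \<le> limsup u" by (rule Liminf_le_Limsup) simp
  with limsup liminf have "liminf u = ennreal l" "limsup u = ennreal l" by auto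
  then have "u \<longlonglongrightarrow> ennreal l" by (intro Liminf_eq_Limsup) auto
  then show "(\<lambda>n. abs_moment M (?t n) r) \<longlonglongrightarrow> abs_moment N T r"
    unfolding l u_def .
qed

end

text \<open>Finiteness of the limit is part of the conclusion because convergence in
  \<open>ennreal\<close> alone would allow the value infinity.\<close>

theorem theorem6p2:
  fixes M :: "'a measure" and N :: "'b measure" and F :: "real measure"
    and X :: "nat \<Rightarrow> 'a \<Rightarrow> real" and T :: "'b \<Rightarrow> real"
    and r :: real and n0 :: nat
  assumes "prob_space M"
    and "prob_space.indep_vars M (\<lambda>_. borel) X {1..}"
    and "\<And>i. i \<ge> 1 \<Longrightarrow> distr M borel (X i) = F"
    and "prob_space N" and "T \<in> borel_measurable N"
    and "weak_conv_m (\<lambda>n. distr M borel (self_normalized_sum X n)) (distr N borel T)"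
    and "r > 0"
    and "n0 \<ge> 2" and "abs_moment M (t_statistic X n0) r < \<infinity>"
  shows "abs_moment N T r < \<infinity> \<and>
    (\<lambda>n. abs_moment M (t_statistic X n) r) \<longlonglongrightarrow> abs_moment N T r"
proof -
  interpret prob_space M by fact
  interpret iid_sequence M X F
    using assms(2,3) by unfold_locales
  obtain a where a: "a \<ge> 0" "\<And>n. prob {\<omega>\<in>space M. \<bar>self_normalized_sum X n \<omega>\<bar> > a} \<le> 1 / 16"
    using self_normalized_sum_tight[OF assms(4-6)] by blast
  define q where "q = nat \<lceil>r + 1\<rceil>"
  have q: "q \<ge> 1" "r + 1 \<le> real (2 * q)"
    using \<open>r > 0\<close> unfolding q_def by linarith+
  obtain C where "C \<ge> 0"
    and "\<And>n. n \<ge> 2 \<Longrightarrow> (\<integral>\<^sup>+\<omega>. ennreal (self_normalized_sum X n \<omega> ^ (2 * q)) \<partial>M) \<le> ennreal C"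
    using self_normalized_sum_moment_bounded[OF a(1) q(1) a(2)] by blast
  note C = this
  obtain k where "4 * a\<^sup>2 \<le> real k"
    using real_arch_simple by blast
  \<comment> \<open>The successor guarantees a positive block length even if
    \<open>k = 0\<close>.\<close>
  moreover define m where "m = Suc k"
  ultimately have "a\<^sup>2 \<le> real m / 4" "m > 0"
    by simp_all
  then have "(\<lambda>n. \<integral>\<^sup>+\<omega>. ennreal (\<bar>t_statistic X n \<omega>\<bar> powr r) *
      indicator {\<omega>. (self_normalized_sum X n \<omega>)\<^sup>2 > 3 / 4 * real n} \<omega> \<partial>M) \<longlonglongrightarrow> 0"
    using a assms(7-9) by (intro t_statistic_moment_large_self_normalized_sum)
  with C show ?thesis
    using t_statistic_moment_tendsto[OF assms(4-7) q(2)] by blast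
qed

end
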